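(* Let $k$ be a field, let $R = k[x_1,\ldots,x_n]$, and let $I$ be an ideal of $R$. For an ideal $J\subseteq R$, let $\operatorname{mono}(J)$ denote the ideal generated by all monomials contained in $J$. Then: (1) If $I$ is prime, then $\operatorname{mono}(I)$ is prime; if $I$ is primary, then $\operatorname{mono}(I)$ is primary. (2) $\operatorname{Ass}(R/\operatorname{mono}(I)) \subseteq \{\operatorname{mono}(P) \mid P \in \operatorname{Ass}(R/I)\}$. (3) $\operatorname{mono}(I)$ is prime if and only if $\operatorname{mono}(I) = \operatorname{mono}(P)$ for some minimal prime $P$ of $I$. In particular, $\operatorname{mono}(I) = 0$ if and only if $\operatorname{mono}(P) = 0$ for some $P \in \operatorname{Min}(I)$.
   Context: A monomial is a product $x_1^{a_1}\cdots x_n^{a_n}$ with $a_i \ge 0$. $\operatorname{mono}(J)$ is the largest monomial ideal contained in $J$. $\operatorname{Ass}(R/J)$ is the set of associated primes of the $R$-module $R/J$, and $\operatorname{Min}(I)$ is the set of primes minimal over $I$. *)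

theory Defs
  imports "HOL-Algebra.QuotRing" "HOL-Algebra.Module" "HOL-Library.Poly_Mapping"
begin

section \<open>Polynomial rings, monomials and \<open>mono(J)\<close>\<close>

text \<open>
  \<open>mpoly_ring n\<close> is \<open>k[x\<^sub>1,\<dots>,x\<^sub>n]\<close>, with the variables numbered \<open>0, \<dots>, n - 1\<close>. A polynomial is a
  finitely supported map from exponent vectors to coefficients, an exponent vector a finitely
  supported map from variable numbers to exponents; the ring operations are those of the library
  (addition is pointwise, multiplication is convolution).
\<close>

type_synonym 'k mpolynomial = "(nat \<Rightarrow>\<^sub>0 nat) \<Rightarrow>\<^sub>0 'k"

definition mpoly_ring :: "nat \<Rightarrow> 'k::field mpolynomial ring" where
  "mpoly_ring n =
    \<lparr>carrier = {p. \<forall>a \<in> Poly_Mapping.keys p. Poly_Mapping.keys a \<subseteq> {..<n}},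
     mult = (*), one = 1, zero = 0, add = (+)\<rparr>"

definition mpoly_var :: "nat \<Rightarrow> 'k::field mpolynomial" where
  "mpoly_var i = Poly_Mapping.single (Poly_Mapping.single i 1) 1"

definition monomials :: "nat \<Rightarrow> 'k::field mpolynomial set" where
  "monomials n = {\<Prod>i<n. mpoly_var i ^ a i | a :: nat \<Rightarrow> nat. True}"

definition mono_ideal :: "nat \<Rightarrow> 'k::field mpolynomial set \<Rightarrow> 'k mpolynomial set" where
  "mono_ideal n J = Idl\<^bsub>mpoly_ring n\<^esub> (J \<inter> monomials n)"


section \<open>Primary ideals, minimal primes and associated primes\<close>

locale primaryideal = ideal + cring +
  assumes I_notcarr: "carrier R \<noteq> I"
    and I_primary: "\<lbrakk>a \<in> carrier R; b \<in> carrier R; a \<otimes> b \<in> I\<rbrakk>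
      \<Longrightarrow> a \<in> I \<or> (\<exists>m::nat. m > 0 \<and> b [^] m \<in> I)"

definition minimal_primes :: "('a, 'b) ring_scheme \<Rightarrow> 'a set \<Rightarrow> 'a set set" where
  "minimal_primes R I =
    {P. primeideal P R \<and> I \<subseteq> P \<and> (\<forall>Q. primeideal Q R \<longrightarrow> I \<subseteq> Q \<longrightarrow> Q \<subseteq> P \<longrightarrow> Q = P)}"

definition annihilator ::
    "('a, 'b) ring_scheme \<Rightarrow> ('a, 'c, 'd) module_scheme \<Rightarrow> 'c \<Rightarrow> 'a set" where
  "annihilator R M x = {r \<in> carrier R. r \<odot>\<^bsub>M\<^esub> x = \<zero>\<^bsub>M\<^esub>}"

definition associated_primes ::
    "('a, 'b) ring_scheme \<Rightarrow> ('a, 'c, 'd) module_scheme \<Rightarrow> 'a set set" where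
  "associated_primes R M = {P. primeideal P R \<and> (\<exists>x \<in> carrier M. P = annihilator R M x)}"

text \<open>
  \<open>R/J\<close> as an \<open>R\<close>-module. The record type \<open>module\<close> extends \<open>ring\<close>, so the ring structure of
  \<^term>\<open>R Quot J\<close> is kept; a scalar \<open>r\<close> acts as multiplication by its residue class.
\<close>

definition quot_module :: "('a, 'b) ring_scheme \<Rightarrow> 'a set \<Rightarrow> ('a, 'a set) module" where
  "quot_module R J =
    \<lparr>carrier = carrier (R Quot J), mult = mult (R Quot J), one = one (R Quot J),
     zero = zero (R Quot J), add = add (R Quot J),
     smult = (\<lambda>r X. (J +>\<^bsub>R\<^esub> r) \<otimes>\<^bsub>R Quot J\<^esub> X)\<rparr>"


section \<open>Basic facts\<close>

lemma mpoly_ring_cring: "cring (mpoly_ring n :: 'k::field mpolynomial ring)"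
proof -
  let ?R = "mpoly_ring n :: 'k mpolynomial ring"
  let ?C = "carrier ?R"
  have C: "p \<in> ?C \<longleftrightarrow> (\<forall>a \<in> Poly_Mapping.keys p. Poly_Mapping.keys a \<subseteq> {..<n})" for p
    by (simp add: mpoly_ring_def)
  have add: "p + q \<in> ?C" if "p \<in> ?C" "q \<in> ?C" for p q
    using that keys_add[of p q] unfolding C by blast
  have minus: "- p \<in> ?C" if "p \<in> ?C" for p
  proof -
    have "Poly_Mapping.keys (- p) = Poly_Mapping.keys p"
      by (simp add: keys.rep_eq uminus_poly_mapping.rep_eq)
    then show ?thesis using that by (simp add: C)
  qed
  have mult: "p * q \<in> ?C" if "p \<in> ?C" "q \<in> ?C" for p q
    unfolding C
  proof
    fix c assume "c \<in> Poly_Mapping.keys (p * q)"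
    then obtain a b where "a \<in> Poly_Mapping.keys p" "b \<in> Poly_Mapping.keys q" "c = a + b"
      using keys_mult[of p q] by blast
    then show "Poly_Mapping.keys c \<subseteq> {..<n}"
      using that keys_add[of a b] unfolding C by blast
  qed
  have ops: "x \<oplus>\<^bsub>?R\<^esub> y = x + y" "x \<otimes>\<^bsub>?R\<^esub> y = x * y" "\<zero>\<^bsub>?R\<^esub> = 0" "\<one>\<^bsub>?R\<^esub> = 1" for x y
    by (simp_all add: mpoly_ring_def)
  have zero_one: "0 \<in> ?C" "1 \<in> ?C"
    by (simp_all add: C)
  show ?thesis
  proof (rule cringI)
    show "abelian_group ?R"
    proof (rule abelian_groupI)
      show "\<exists>y\<in>?C. y \<oplus>\<^bsub>?R\<^esub> x = \<zero>\<^bsub>?R\<^esub>" if "x \<in> ?C" for x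
        by (rule bexI[OF _ minus[OF that]]) (simp add: ops)
    qed (simp_all add: ops zero_one add ac_simps)
    show "Group.comm_monoid ?R"
      by (rule comm_monoidI) (simp_all add: ops zero_one mult ac_simps)
  qed (simp add: ops distrib_right)
qed

lemma prod_mpoly_var_power:
  "(\<Prod>i\<in>A. mpoly_var i ^ a i) =
    (Poly_Mapping.single (\<Sum>i\<in>A. Poly_Mapping.single i (a i)) 1 :: 'k::field mpolynomial)"
proof -
  have pow: "(mpoly_var i ^ m :: 'k mpolynomial)
      = Poly_Mapping.single (Poly_Mapping.single i m) 1" for i m
    by (induction m) (simp_all add: mpoly_var_def mult_single single_add[symmetric])
  show ?thesis
    by (induction A rule: infinite_finite_induct) (simp_all add: pow mult_single)
qed

lemma monomials_eq:
  "monomials n =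
    {Poly_Mapping.single a (1 :: 'k::field) | a. Poly_Mapping.keys a \<subseteq> {..<n}}"
proof (intro equalityI subsetI)
  fix p :: "'k mpolynomial" assume "p \<in> monomials n"
  then obtain a where
    "p = Poly_Mapping.single (\<Sum>i<n. Poly_Mapping.single i (a i)) 1"
    by (auto simp: monomials_def prod_mpoly_var_power)
  moreover have "Poly_Mapping.keys (\<Sum>i<n. Poly_Mapping.single i (a i)) \<subseteq> {..<n}"
    using keys_sum[of "\<lambda>i. Poly_Mapping.single i (a i)" "{..<n}"]
    by (auto split: if_splits)
  ultimately show
    "p \<in> {Poly_Mapping.single a (1 :: 'k) | a. Poly_Mapping.keys a \<subseteq> {..<n}}"
    by blast
next
  fix p :: "'k mpolynomial"
  assume "p \<in> {Poly_Mapping.single a (1 :: 'k) | a. Poly_Mapping.keys a \<subseteq> {..<n}}"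
  then obtain a where a: "p = Poly_Mapping.single a 1" "Poly_Mapping.keys a \<subseteq> {..<n}"
    by blast
  have "(\<Sum>i<n. Poly_Mapping.single i (Poly_Mapping.lookup a i)) = a"
  proof (rule poly_mapping_eqI)
    fix j
    have "Poly_Mapping.lookup (\<Sum>i<n. Poly_Mapping.single i (Poly_Mapping.lookup a i)) j
        = (\<Sum>i<n. if i = j then Poly_Mapping.lookup a i else 0)"
      by (simp add: lookup_sum lookup_single when_def)
    also have "\<dots> = Poly_Mapping.lookup a j"
      using a(2) by (auto simp: in_keys_iff)
    finally show "Poly_Mapping.lookup (\<Sum>i<n. Poly_Mapping.single i (Poly_Mapping.lookup a i)) j
        = Poly_Mapping.lookup a j" .
  qed
  then have "p = (\<Prod>i<n. mpoly_var i ^ Poly_Mapping.lookup a i)"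
    using a(1) by (simp add: prod_mpoly_var_power)
  then show "p \<in> monomials n"
    by (auto simp: monomials_def)
qed

lemma monomials_subset_carrier: "monomials n \<subseteq> carrier (mpoly_ring n)"
  by (auto simp: monomials_eq mpoly_ring_def)

lemma mono_ideal_ideal: "ideal (mono_ideal n J) (mpoly_ring n)"
proof -
  interpret cring "mpoly_ring n :: 'a mpolynomial ring" by (rule mpoly_ring_cring)
  show ?thesis
    unfolding mono_ideal_def
    by (rule genideal_ideal) (use monomials_subset_carrier in blast)
qed

lemma quot_module_module:
  fixes R (structure)
  assumes "cring R" "ideal J R"
  shows "module R (quot_module R J)"
proof -
  interpret cring R by fact
  interpret ideal J R by fact
  interpret Q: cring "R Quot J" by (rule quotient_is_cring) fact
  interpret h: ring_hom_cring R "R Quot J" "(+>) J" by (rule rcos_ring_hom_cring) fact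
  have ag: "abelian_group (quot_module R J)"
  proof (rule abelian_groupI)
    show "\<exists>y\<in>carrier (quot_module R J). y \<oplus>\<^bsub>quot_module R J\<^esub> x = \<zero>\<^bsub>quot_module R J\<^esub>"
      if "x \<in> carrier (quot_module R J)" for x
      using that Q.add.l_inv_ex[of x] by (simp add: quot_module_def)
  qed (simp_all add: quot_module_def Q.a_ac)
  show ?thesis
    by (rule moduleI[OF \<open>cring R\<close> ag])
      (simp_all add: quot_module_def Q.l_distr Q.r_distr Q.m_assoc)
qed

end

(* A polynomial lies in mono(I) iff the monomials of all its terms lie in I. Comparing leading terms,
   primality and primariness of mono(I) therefore only have to be tested on monomials.
   An associated prime Q of R/mono(I) is (mono(I) : m) = mono(I : m) for a monomial m: take x with
   Q = ann(x) having as few terms as possible. The monomials outside Q form a multiplicative set T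
   that misses (I : m), and an ideal maximal among the colon ideals (I : y) that contain (I : m) and
   miss T, which exists since R is Noetherian, is an associated prime P of R/I with mono(P) = Q.
   The same construction with m = 1, followed by passing to a minimal prime inside P, gives (3). *)

theory Submission
  imports Defs Complex_Main
begin

section \<open>Colon ideals, associated primes and minimal primes\<close>

text \<open>Being maximal among the colon ideals that miss T is weaker than being maximal among all
  ideals that miss T. The resulting prime P satisfies mono(P) = Q by a squeeze: P contains (I : m),
  whose monomials are exactly those of Q, and missing T excludes every other monomial. This is why T
  consists of monomials only, and the same squeeze allows the passage to a minimal prime between I
  and P. The monomial m is found without a grading on R/mono(I): the minimal number of terms of x
  takes its place, because any term of x that could be dropped without changing the annihilator
  gives a contradiction.\<close>

definition colon_ideal :: "('a, 'b) ring_scheme \<Rightarrow> 'a set \<Rightarrow> 'a \<Rightarrow> 'a set" where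
  "colon_ideal R J x = {r \<in> carrier R. r \<otimes>\<^bsub>R\<^esub> x \<in> J}"

lemma colon_ideal_ideal:
  fixes R (structure)
  assumes "cring R" "ideal J R" "x \<in> carrier R"
  shows "ideal (colon_ideal R J x) R"
proof -
  interpret cring R by fact
  interpret J: ideal J R by fact
  note [simp] = \<open>x \<in> carrier R\<close>
  have "subgroup (colon_ideal R J x) (add_monoid R)"
  proof (rule add.subgroupI)
    show "colon_ideal R J x \<noteq> {}"
      using J.zero_closed by (auto simp: colon_ideal_def intro!: exI[of _ \<zero>])
    show "\<ominus> a \<in> colon_ideal R J x" if "a \<in> colon_ideal R J x" for a
      using that J.a_inv_closed by (auto simp: colon_ideal_def l_minus)
  qed (auto simp: colon_ideal_def l_distr J.a_closed)
  moreover have "r \<otimes> a \<in> colon_ideal R J x"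
    if "a \<in> colon_ideal R J x" "r \<in> carrier R" for a r
    using that by (auto simp: colon_ideal_def m_assoc J.I_l_closed)
  ultimately show ?thesis
    by (intro idealI ring_axioms) (auto simp: colon_ideal_def m_comm)
qed

lemma annihilator_quot_module:
  fixes R (structure)
  assumes "cring R" "ideal J R" "x \<in> carrier R"
  shows "annihilator R (quot_module R J) (J +> x) = colon_ideal R J x"
proof -
  interpret cring R by fact
  interpret J: ideal J R by fact
  have "(J +> r) \<otimes>\<^bsub>R Quot J\<^esub> (J +> x) = \<zero>\<^bsub>R Quot J\<^esub> \<longleftrightarrow> r \<otimes> x \<in> J" if "r \<in> carrier R" for r
    using that assms(3) J.rcos_const_imp_mem[of "r \<otimes> x"] J.a_rcos_const[of "r \<otimes> x"]
    by (auto simp: FactRing_def J.rcoset_mult_add)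
  then show ?thesis
    by (auto simp: annihilator_def quot_module_def colon_ideal_def)
qed

text \<open>Every element of R/J is a class of some \<open>x\<close>, and the annihilator of that
  class is (J : x). From here on associated primes are prime colon ideals and cosets disappear from
  the argument.\<close>

lemma associated_primes_quot_module:
  fixes R (structure)
  assumes "cring R" "ideal J R"
  shows "associated_primes R (quot_module R J) =
    {P. primeideal P R \<and> (\<exists>x \<in> carrier R. P = colon_ideal R J x)}"
proof -
  have "carrier (quot_module R J) = (\<lambda>x. J +> x) ` carrier R"
    by (auto simp: quot_module_def FactRing_def A_RCOSETS_def')
  then show ?thesis
    by (auto simp: associated_primes_def annihilator_quot_module[OF assms])
qed

text \<open>Let (I : y) be maximal and ab in it. If (I : ay) misses \<open>T\<close>, maximality
  makes it equal to (I : y), and it contains b. Otherwise tay lies in \<open>I\<close> for some t in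
  \<open>T\<close>, so a lies in (I : ty); this ideal misses \<open>T\<close> because
  \<open>T\<close> is multiplicative and (I : y) misses \<open>T\<close>, so it also equals (I : y).
  With T = {1} this is the classical existence proof for associated primes.\<close>

lemma exists_prime_colon_ideal:
  fixes R (structure)
  assumes "cring R" and I: "ideal I R"
    and acc: "wf {(J', J). ideal J' R \<and> ideal J R \<and> J \<subset> J'}"
    and T: "T \<subseteq> carrier R" "\<one> \<in> T" "\<And>s t. s \<in> T \<Longrightarrow> t \<in> T \<Longrightarrow> s \<otimes> t \<in> T"
    and x: "x \<in> carrier R" "colon_ideal R I x \<inter> T = {}"
  obtains y where "y \<in> carrier R" "primeideal (colon_ideal R I y) R"
    "colon_ideal R I x \<subseteq> colon_ideal R I y" "colon_ideal R I y \<inter> T = {}"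
proof -
  interpret cring R by fact
  interpret I: ideal I R by fact
  define F where "F = {y \<in> carrier R. colon_ideal R I x \<subseteq> colon_ideal R I y \<and>
    colon_ideal R I y \<inter> T = {}}"
  have "colon_ideal R I x \<in> colon_ideal R I ` F"
    using x by (auto simp: F_def)
  \<comment> \<open>The relation puts the larger ideal below the smaller one, so a minimal element
    for it is a maximal colon ideal.\<close>
  with acc obtain J where "J \<in> colon_ideal R I ` F" and
    J: "\<And>K. (K, J) \<in> {(J', J). ideal J' R \<and> ideal J R \<and> J \<subset> J'} \<Longrightarrow> K \<notin> colon_ideal R I ` F"
    by (rule wfE_min) blast
  then obtain y where y: "y \<in> F" "J = colon_ideal R I y"
    by blast
  have yR [simp]: "y \<in> carrier R"
    using y by (simp add: F_def)
  have mono: "colon_ideal R I y \<subseteq> colon_ideal R I (a \<otimes> y)" if "a \<in> carrier R" for a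
    using that by (auto simp: colon_ideal_def m_lcomm[of _ a y] I.I_l_closed)
  have max: "colon_ideal R I (a \<otimes> y) = colon_ideal R I y"
    if "a \<in> carrier R" "colon_ideal R I (a \<otimes> y) \<inter> T = {}" for a
  proof (rule ccontr)
    assume "colon_ideal R I (a \<otimes> y) \<noteq> colon_ideal R I y"
    then have "colon_ideal R I (a \<otimes> y) \<notin> colon_ideal R I ` F"
      using that mono[of a] y(2) colon_ideal_ideal[OF \<open>cring R\<close> I] by (intro J) auto
    moreover have "a \<otimes> y \<in> F"
      using that y(1) mono[of a] by (auto simp: F_def)
    ultimately show False by blast
  qed
  have "primeideal (colon_ideal R I y) R"
  proof (rule primeidealI[OF colon_ideal_ideal[OF \<open>cring R\<close> I yR] \<open>cring R\<close>])
    show "carrier R \<noteq> colon_ideal R I y"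
      using y(1) T(2) by (auto simp: F_def)
    fix a b assume ab: "a \<in> carrier R" "b \<in> carrier R" "a \<otimes> b \<in> colon_ideal R I y"
    show "a \<in> colon_ideal R I y \<or> b \<in> colon_ideal R I y"
    proof (cases "colon_ideal R I (a \<otimes> y) \<inter> T = {}")
      case True
      have "b \<in> colon_ideal R I (a \<otimes> y)"
        using ab by (simp add: colon_ideal_def m_assoc[symmetric] m_comm[of b a])
      with max[OF ab(1) True] show ?thesis by simp
    next
      case False
      then obtain t where t: "t \<in> T" "t \<in> carrier R" "t \<otimes> (a \<otimes> y) \<in> I"
        by (auto simp: colon_ideal_def)
      have "colon_ideal R I (t \<otimes> y) \<inter> T = {}"
      proof (rule ccontr)
        assume "colon_ideal R I (t \<otimes> y) \<inter> T \<noteq> {}"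
        then obtain s where s: "s \<in> T" "s \<in> carrier R" "s \<otimes> (t \<otimes> y) \<in> I"
          by (auto simp: colon_ideal_def)
        then have "s \<otimes> t \<in> colon_ideal R I y \<inter> T"
          using t T by (simp add: colon_ideal_def m_assoc)
        then show False
          using y(1) by (auto simp: F_def)
      qed
      from max[OF t(2) this] have "colon_ideal R I (t \<otimes> y) = colon_ideal R I y" .
      moreover have "a \<in> colon_ideal R I (t \<otimes> y)"
        using ab t by (simp add: colon_ideal_def m_lcomm)
      ultimately show ?thesis by simp
    qed
  qed
  with y(1) show ?thesis
    by (intro that[of y]) (auto simp: F_def)
qed

text \<open>Zorn's lemma applies because the intersection of a chain of primes is prime: if a and b
  are each missed by some member of the chain, the smaller of these two members misses both.\<close>

lemma minimal_prime_below:
  fixes R (structure)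
  assumes P: "primeideal P R" "I \<subseteq> P"
  obtains Q where "Q \<in> minimal_primes R I" "Q \<subseteq> P"
proof -
  interpret P: primeideal P R by fact
  \<comment> \<open>Complements reverse inclusion, so that the upward form of Zorn's lemma yields a
    minimal prime.\<close>
  define A where "A = {- Q | Q. primeideal Q R \<and> I \<subseteq> Q \<and> Q \<subseteq> P}"
  have "\<exists>M\<in>A. \<forall>X\<in>A. M \<subseteq> X \<longrightarrow> X = M"
  proof (rule subset_Zorn_nonempty)
    show "A \<noteq> {}"
      using P by (auto simp: A_def)
    fix \<C> assume C: "\<C> \<noteq> {}" "subset.chain A \<C>"
    define S where "S = uminus ` \<C>"
    have S: "primeideal Q R" "I \<subseteq> Q" "Q \<subseteq> P" if "Q \<in> S" for Q
      using C(2) that by (auto simp: S_def A_def subset.chain_def)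
    have "S \<noteq> {}"
      using C(1) by (simp add: S_def)
    have total: "Q \<subseteq> Q' \<or> Q' \<subseteq> Q" if "Q \<in> S" "Q' \<in> S" for Q Q'
      using C(2) that by (auto simp: S_def subset_chain_def)
    have "primeideal (\<Inter>S) R"
    proof (rule primeidealI[OF P.i_Intersect P.is_cring])
      show "ideal Q R" if "Q \<in> S" for Q
        using S(1)[OF that] by (simp add: primeideal_def)
      show "S \<noteq> {}" by fact
      show "carrier R \<noteq> \<Inter>S"
        using S \<open>S \<noteq> {}\<close> P.I_notcarr P.a_subset by blast
      fix a b assume ab: "a \<in> carrier R" "b \<in> carrier R" "a \<otimes> b \<in> \<Inter>S"
      show "a \<in> \<Inter>S \<or> b \<in> \<Inter>S"
      proof (rule ccontr)
        assume "\<not> ?thesis"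
        then obtain Q Q' where "Q \<in> S" "a \<notin> Q" "Q' \<in> S" "b \<notin> Q'" by blast
        with total[of Q Q'] obtain Q'' where "Q'' \<in> S" "a \<notin> Q''" "b \<notin> Q''" by blast
        then show False
          using ab S(1)[of Q''] primeideal.I_prime by fastforce
      qed
    qed
    moreover have "I \<subseteq> \<Inter>S" "\<Inter>S \<subseteq> P"
      using S \<open>S \<noteq> {}\<close> by blast+
    moreover have "\<Union>\<C> = - \<Inter>S"
      by (auto simp: S_def)
    ultimately show "\<Union>\<C> \<in> A"
      unfolding A_def by blast
  qed
  then obtain M where M: "M \<in> A" "\<And>X. X \<in> A \<Longrightarrow> M \<subseteq> X \<Longrightarrow> X = M"
    by blast
  from M(1) obtain Q where Q: "M = - Q" "primeideal Q R" "I \<subseteq> Q" "Q \<subseteq> P"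
    unfolding A_def by blast
  have "Q' = Q" if Q': "primeideal Q' R" "I \<subseteq> Q'" "Q' \<subseteq> Q" for Q'
  proof -
    have "- Q' \<in> A"
      unfolding A_def using Q' Q(4) by blast
    from M(2)[OF this] show ?thesis
      using Q(1) Q'(3) by auto
  qed
  with Q show ?thesis
    by (intro that[of Q]) (auto simp: minimal_primes_def)
qed


section \<open>Ideals of polynomial rings\<close>

lemma mpoly_ring_ops [simp]:
  "x \<otimes>\<^bsub>mpoly_ring n\<^esub> y = x * y" "x \<oplus>\<^bsub>mpoly_ring n\<^esub> y = x + y"
  "\<one>\<^bsub>mpoly_ring n\<^esub> = 1" "\<zero>\<^bsub>mpoly_ring n\<^esub> = 0"
  by (simp_all add: mpoly_ring_def)

lemma mpoly_ring_nat_pow [simp]: "x [^]\<^bsub>mpoly_ring n\<^esub> (m::nat) = x ^ m"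
  by (induction m) (simp_all add: nat_pow_def mult.commute)

lemma mpoly_carrier_iff:
  "p \<in> carrier (mpoly_ring n) \<longleftrightarrow> (\<forall>a \<in> Poly_Mapping.keys p. Poly_Mapping.keys a \<subseteq> {..<n})"
  by (simp add: mpoly_ring_def)

lemma mpoly_carrier_single:
  "Poly_Mapping.keys a \<subseteq> {..<n} \<Longrightarrow> Poly_Mapping.single a c \<in> carrier (mpoly_ring n)"
  by (simp add: mpoly_carrier_iff)

lemma mpoly_uminus:
  fixes p :: "'k::field mpolynomial"
  assumes "p \<in> carrier (mpoly_ring n)"
  shows "\<ominus>\<^bsub>mpoly_ring n\<^esub> p = - p"
proof -
  interpret cring "mpoly_ring n :: 'k mpolynomial ring" by (rule mpoly_ring_cring)
  have "- p \<in> carrier (mpoly_ring n)"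
    using assms by (simp add: mpoly_carrier_iff keys.rep_eq uminus_poly_mapping.rep_eq)
  then show ?thesis
    using assms by (intro minus_equality) simp_all
qed

lemma mpoly_carrier_closed:
  fixes p q :: "'k::field mpolynomial"
  assumes "p \<in> carrier (mpoly_ring n)" "q \<in> carrier (mpoly_ring n)"
  shows "p + q \<in> carrier (mpoly_ring n)" "p - q \<in> carrier (mpoly_ring n)"
    "p * q \<in> carrier (mpoly_ring n)"
proof -
  interpret cring "mpoly_ring n :: 'k mpolynomial ring" by (rule mpoly_ring_cring)
  show "p + q \<in> carrier (mpoly_ring n)" "p * q \<in> carrier (mpoly_ring n)"
    using a_closed[OF assms] m_closed[OF assms] by simp_all
  show "p - q \<in> carrier (mpoly_ring n)"
    using minus_closed[OF assms] assms(2) by (simp add: a_minus_def mpoly_uminus)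
qed

lemma mpoly_carrier_uminus:
  fixes p :: "'k::field mpolynomial"
  assumes "p \<in> carrier (mpoly_ring n)"
  shows "- p \<in> carrier (mpoly_ring n)"
  using assms by (simp add: mpoly_carrier_iff keys.rep_eq uminus_poly_mapping.rep_eq)

lemma mpoly_carrier_power:
  fixes p :: "'k::field mpolynomial"
  assumes "p \<in> carrier (mpoly_ring n)"
  shows "p ^ m \<in> carrier (mpoly_ring n)"
proof -
  interpret cring "mpoly_ring n :: 'k mpolynomial ring" by (rule mpoly_ring_cring)
  show ?thesis
    using nat_pow_closed[OF assms, of m] by simp
qed

lemma mpoly_zero_one_closed:
  "0 \<in> carrier (mpoly_ring n)" "1 \<in> carrier (mpoly_ring n)"
  by (simp_all add: mpoly_carrier_iff)

lemma mpoly_ideal_closed: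
  fixes I :: "'k::field mpolynomial set"
  assumes "ideal I (mpoly_ring n)"
  shows "p \<in> I \<Longrightarrow> p \<in> carrier (mpoly_ring n)" "0 \<in> I"
    "p \<in> I \<Longrightarrow> q \<in> I \<Longrightarrow> p + q \<in> I" "p \<in> I \<Longrightarrow> q \<in> I \<Longrightarrow> p - q \<in> I"
    "p \<in> I \<Longrightarrow> r \<in> carrier (mpoly_ring n) \<Longrightarrow> r * p \<in> I"
    "p \<in> I \<Longrightarrow> r \<in> carrier (mpoly_ring n) \<Longrightarrow> p * r \<in> I"
proof -
  interpret ideal I "mpoly_ring n" by fact
  show C: "p \<in> I \<Longrightarrow> p \<in> carrier (mpoly_ring n)" for p by (rule Icarr)
  show "0 \<in> I" using additive_subgroup.zero_closed[OF is_additive_subgroup] by simp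
  show add: "p \<in> I \<Longrightarrow> q \<in> I \<Longrightarrow> p + q \<in> I" for p q 
    using additive_subgroup.a_closed[OF is_additive_subgroup, of p q] by simp
  show "p \<in> I \<Longrightarrow> r \<in> carrier (mpoly_ring n) \<Longrightarrow> r * p \<in> I" using I_l_closed[of p r] by simp
  show "p \<in> I \<Longrightarrow> r \<in> carrier (mpoly_ring n) \<Longrightarrow> p * r \<in> I" using I_r_closed[of p r] by simp
  show "p \<in> I \<Longrightarrow> q \<in> I \<Longrightarrow> p - q \<in> I"
    using add[of p "- q"] additive_subgroup.a_inv_closed[OF is_additive_subgroup, of q] C[of q] by (simp add: mpoly_uminus)
qed

lemma mpoly_idealI:
  fixes J :: "'k::field mpolynomial set"
  assumes "J \<subseteq> carrier (mpoly_ring n)" "0 \<in> J" "\<And>p q. p \<in> J \<Longrightarrow> q \<in> J \<Longrightarrow> p + q \<in> J"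
    and mult: "\<And>r p. p \<in> J \<Longrightarrow> r \<in> carrier (mpoly_ring n) \<Longrightarrow> r * p \<in> J"
  shows "ideal J (mpoly_ring n)"
proof -
  interpret cring "mpoly_ring n :: 'k mpolynomial ring" by (rule mpoly_ring_cring)
  have "subgroup J (add_monoid (mpoly_ring n))"
  proof (rule add.subgroupI)
    show "\<ominus>\<^bsub>mpoly_ring n\<^esub> p \<in> J" if "p \<in> J" for p
      using mult[OF that mpoly_carrier_uminus[OF mpoly_zero_one_closed(2)]] that assms(1)
      by (auto simp: mpoly_uminus)
  qed (use assms in auto)
  then show ?thesis
    by (intro idealI ring_axioms) (use mult in \<open>auto simp: mult.commute\<close>)
qed

lemma lookup_sum_single:
  assumes "A \<subseteq> Poly_Mapping.keys p"
  shows "Poly_Mapping.lookup (\<Sum>a\<in>A. Poly_Mapping.single a (Poly_Mapping.lookup p a)) b =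
    (Poly_Mapping.lookup p b when b \<in> A)"
  using finite_subset[OF assms finite_keys]
  by (auto simp: lookup_sum lookup_single when_def)

lemma poly_mapping_sum_single:
  "(\<Sum>a\<in>Poly_Mapping.keys p. Poly_Mapping.single a (Poly_Mapping.lookup p a)) = p"
  by (rule poly_mapping_eqI) (simp add: lookup_sum_single when_def in_keys_iff)

text \<open>Sorts the terms of a polynomial without cancellation. Later \<open>E\<close> says that a
  monomial lies in an ideal, or that a positive power of it does.\<close>

lemma poly_mapping_split:
  fixes p :: "'a \<Rightarrow>\<^sub>0 'b::comm_monoid_add"
  obtains p0 p1 where "p = p0 + p1" "Poly_Mapping.keys p0 = {a \<in> Poly_Mapping.keys p. \<not> E a}"
    "Poly_Mapping.keys p1 = {a \<in> Poly_Mapping.keys p. E a}"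
proof -
  define part where "part A = (\<Sum>a\<in>A. Poly_Mapping.single a (Poly_Mapping.lookup p a))" for A
  have lookup_part: "Poly_Mapping.lookup (part A) b = (Poly_Mapping.lookup p b when b \<in> A)"
    if "A \<subseteq> Poly_Mapping.keys p" for A b
    unfolding part_def using that by (rule lookup_sum_single)
  define A0 A1 where "A0 = {a \<in> Poly_Mapping.keys p. \<not> E a}" and "A1 = {a \<in> Poly_Mapping.keys p. E a}"
  have A: "A0 \<subseteq> Poly_Mapping.keys p" "A1 \<subseteq> Poly_Mapping.keys p"
    by (auto simp: A0_def A1_def)
  show ?thesis
  proof
    show "p = part A0 + part A1"
      by (rule poly_mapping_eqI)
        (simp add: lookup_add lookup_part[OF A(1)] lookup_part[OF A(2)],
          auto simp: when_def A0_def A1_def in_keys_iff)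
    show "Poly_Mapping.keys (part A0) = {a \<in> Poly_Mapping.keys p. \<not> E a}"
      by (simp add: set_eq_iff in_keys_iff lookup_part[OF A(1)], simp add: when_def A0_def in_keys_iff, blast)
    show "Poly_Mapping.keys (part A1) = {a \<in> Poly_Mapping.keys p. E a}"
      by (simp add: set_eq_iff in_keys_iff lookup_part[OF A(2)], simp add: when_def A1_def in_keys_iff, blast)
  qed
qed

text \<open>The right-hand side defines an ideal, since each exponent of a product is a sum of
  exponents of the factors and \<open>J\<close> absorbs monomial factors; it contains the generators
  of mono(J). Conversely, such a polynomial is a linear combination of monomials in
  \<open>J\<close>.\<close>

lemma mono_ideal_iff:
  fixes J :: "'k::field mpolynomial set"
  assumes "ideal J (mpoly_ring n)"
  shows "p \<in> mono_ideal n J \<longleftrightarrow>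
    p \<in> carrier (mpoly_ring n) \<and> (\<forall>a \<in> Poly_Mapping.keys p. Poly_Mapping.single a 1 \<in> J)"
proof -
  interpret cring "mpoly_ring n :: 'k mpolynomial ring" by (rule mpoly_ring_cring)
  note cl = mpoly_ideal_closed[OF assms]
  define N :: "'k mpolynomial set" where "N = {p \<in> carrier (mpoly_ring n).
    \<forall>a \<in> Poly_Mapping.keys p. Poly_Mapping.single a 1 \<in> J}"
  have "ideal N (mpoly_ring n)"
  proof (rule mpoly_idealI)
    show "p + q \<in> N" if "p \<in> N" "q \<in> N" for p q
      using that keys_add[of p q] by (auto simp: N_def mpoly_carrier_closed)
    show "r * p \<in> N" if p: "p \<in> N" and r: "r \<in> carrier (mpoly_ring n)" for r p
    proof -
      have "Poly_Mapping.single c 1 \<in> J" if c: "c \<in> Poly_Mapping.keys (r * p)"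
        for c :: "nat \<Rightarrow>\<^sub>0 nat"
      proof -
        obtain b a where ab: "b \<in> Poly_Mapping.keys r" "a \<in> Poly_Mapping.keys p" "c = b + a"
          using c keys_mult[of r p] by blast
        then have "Poly_Mapping.single b 1 * Poly_Mapping.single a 1 \<in> J"
          using p r by (intro cl(5)) (auto simp: N_def mpoly_carrier_iff)
        then show ?thesis
          using ab by (simp add: mult_single)
      qed
      then show ?thesis
        using p r by (simp add: N_def mpoly_carrier_closed)
    qed
  qed (auto simp: N_def mpoly_zero_one_closed)
  moreover have "J \<inter> monomials n \<subseteq> N"
    by (auto simp: N_def monomials_eq mpoly_carrier_iff)
  ultimately have "mono_ideal n J \<subseteq> N"
    unfolding mono_ideal_def by (rule genideal_minimal)
  moreover have "p \<in> mono_ideal n J" if p: "p \<in> N" for p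
  proof -
    have M: "ideal (mono_ideal n J) (mpoly_ring n)" by (rule mono_ideal_ideal)
    have mon: "J \<inter> monomials n \<subseteq> mono_ideal n J"
      unfolding mono_ideal_def by (rule genideal_self) (use monomials_subset_carrier in blast)
    have "(\<Sum>a\<in>A. Poly_Mapping.single a (Poly_Mapping.lookup p a)) \<in> mono_ideal n J"
      if "A \<subseteq> Poly_Mapping.keys p" for A
      using finite_subset[OF that finite_keys] that
    proof (induction A rule: finite_induct)
      case empty
      then show ?case by (simp add: mpoly_ideal_closed[OF M])
    next
      case (insert a A)
      have "Poly_Mapping.single a 1 \<in> mono_ideal n J"
        using insert.prems p by (intro subsetD[OF mon]) (auto simp: N_def mpoly_carrier_iff monomials_eq)
      then have "Poly_Mapping.single 0 (Poly_Mapping.lookup p a) * Poly_Mapping.single a 1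
          \<in> mono_ideal n J"
        by (rule mpoly_ideal_closed(5)[OF M]) (simp add: mpoly_carrier_iff)
      then show ?case
        using insert by (auto simp: mult_single intro: mpoly_ideal_closed(3)[OF M])
    qed
    from this[OF order_refl] show ?thesis
      by (simp add: poly_mapping_sum_single)
  qed
  ultimately show ?thesis
    by (auto simp: N_def)
qed

lemma mono_ideal_cong:
  assumes "P \<inter> monomials n = Q \<inter> monomials n"
  shows "mono_ideal n P = mono_ideal n Q"
  using assms by (simp add: mono_ideal_def)

lemma single_in_mono_ideal_iff:
  fixes J :: "'k::field mpolynomial set"
  assumes "ideal J (mpoly_ring n)"
  shows "Poly_Mapping.single a 1 \<in> mono_ideal n J \<longleftrightarrow> Poly_Mapping.single a 1 \<in> J"
  using mpoly_ideal_closed(1)[OF assms] by (auto simp: mono_ideal_iff[OF assms])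


section \<open>Leading monomials and the ascending chain condition\<close>

text \<open>Only one summand of the convolution can contribute at \<open>a + b\<close>. The
  exponents \<open>a\<close> and \<open>b\<close> need not be keys; if one is not, both sides
  vanish. This covers products of leading terms as well as multiplication by a single term.\<close>

lemma lookup_mult_unique:
  fixes p q :: "'a::cancel_comm_monoid_add \<Rightarrow>\<^sub>0 'k::comm_ring_1"
  assumes "\<And>a' b'. a' \<in> Poly_Mapping.keys p \<Longrightarrow> b' \<in> Poly_Mapping.keys q \<Longrightarrow>
    a' + b' = a + b \<Longrightarrow> a' = a \<and> b' = b"
  shows "Poly_Mapping.lookup (p * q) (a + b) = Poly_Mapping.lookup p a * Poly_Mapping.lookup q b"
proof -
  define c d where "c = Poly_Mapping.lookup p a" and "d = Poly_Mapping.lookup q b"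
  define p' q' where "p' = p - Poly_Mapping.single a c" and "q' = q - Poly_Mapping.single b d"
  have p': "a' \<in> Poly_Mapping.keys p \<and> a' \<noteq> a" if "a' \<in> Poly_Mapping.keys p'" for a'
    using that by (auto simp: p'_def c_def in_keys_iff lookup_minus lookup_single when_def split: if_splits)
  have q': "b' \<in> Poly_Mapping.keys q \<and> b' \<noteq> b" if "b' \<in> Poly_Mapping.keys q'" for b'
    using that by (auto simp: q'_def d_def in_keys_iff lookup_minus lookup_single when_def split: if_splits)
  \<comment> \<open>With the terms at \<open>a\<close> and \<open>b\<close> split off, neither of
    the last two products can reach the exponent \<open>a + b\<close>.\<close>
  have "p * q = Poly_Mapping.single (a + b) (c * d) + Poly_Mapping.single a c * q' + p' * q"
    by (simp add: p'_def q'_def algebra_simps mult_single)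
  moreover have "a + b \<notin> Poly_Mapping.keys (Poly_Mapping.single a c * q')"
  proof
    assume "a + b \<in> Poly_Mapping.keys (Poly_Mapping.single a c * q')"
    then obtain b' where "b' \<in> Poly_Mapping.keys q'" "a + b = a + b'"
      using keys_mult[of "Poly_Mapping.single a c" q'] by (auto split: if_splits)
    then show False using q'[of b'] by simp
  qed
  moreover have "a + b \<notin> Poly_Mapping.keys (p' * q)"
  proof
    assume "a + b \<in> Poly_Mapping.keys (p' * q)"
    then obtain a' b' where "a' \<in> Poly_Mapping.keys p'" "b' \<in> Poly_Mapping.keys q" "a + b = a' + b'"
      using keys_mult[of p' q] by blast
    then show False using p'[of a'] assms[of a' b'] by simp
  qed
  ultimately show ?thesis
    by (simp add: lookup_add in_keys_iff c_def d_def)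
qed

lemma lookup_mult_single:
  fixes p :: "'a::cancel_comm_monoid_add \<Rightarrow>\<^sub>0 'k::comm_ring_1"
  shows "Poly_Mapping.lookup (p * Poly_Mapping.single b c) (a + b) = Poly_Mapping.lookup p a * c"
  by (subst lookup_mult_unique) (auto split: if_splits)

lemma keys_mult_monomial:
  fixes p :: "'k::field mpolynomial"
  shows "Poly_Mapping.keys (p * Poly_Mapping.single b 1) = (\<lambda>a. a + b) ` Poly_Mapping.keys p"
proof
  show "Poly_Mapping.keys (p * Poly_Mapping.single b 1) \<subseteq> (\<lambda>a. a + b) ` Poly_Mapping.keys p"
    using keys_mult[of p "Poly_Mapping.single b 1"] by auto
qed (auto simp: in_keys_iff lookup_mult_single)

text \<open>The order is the lexicographic order on finitely supported maps, with the lowest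
  variable number most significant. It is total and compatible with addition, hence serves as the
  term order. \<open>lead_exp 0\<close> is the unspecified maximum of the empty set, so lemmas using
  its value assume a nonzero polynomial.\<close>

definition lead_exp :: "'k::field mpolynomial \<Rightarrow> nat \<Rightarrow>\<^sub>0 nat" where
  "lead_exp p = Max (Poly_Mapping.keys p)"

lemma lead_exp_in_keys: "p \<noteq> 0 \<Longrightarrow> lead_exp p \<in> Poly_Mapping.keys p"
  unfolding lead_exp_def by (rule Max_in) auto

lemma lead_exp_ge: "a \<in> Poly_Mapping.keys p \<Longrightarrow> a \<le> lead_exp p"
  unfolding lead_exp_def by (rule Max_ge) auto

text \<open>Addition is strictly monotone, so only the two leading exponents add up to this sum, and
  their coefficients have a nonzero product in a field.\<close>

lemma lead_exp_mult_in_keys: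
  fixes p q :: "'k::field mpolynomial"
  assumes "p \<noteq> 0" "q \<noteq> 0"
  shows "lead_exp p + lead_exp q \<in> Poly_Mapping.keys (p * q)"
proof -
  have "Poly_Mapping.lookup (p * q) (lead_exp p + lead_exp q) =
      Poly_Mapping.lookup p (lead_exp p) * Poly_Mapping.lookup q (lead_exp q)"
  proof (rule lookup_mult_unique)
    fix a b
    assume ab: "a \<in> Poly_Mapping.keys p" "b \<in> Poly_Mapping.keys q" "a + b = lead_exp p + lead_exp q"
    show "a = lead_exp p \<and> b = lead_exp q"
    proof (rule ccontr)
      assume "\<not> ?thesis"
      with ab lead_exp_ge[of a p] lead_exp_ge[of b q]
      have "a + b < lead_exp p + lead_exp q"
        by (metis add_le_less_mono add_less_le_mono le_neq_trans)
      with ab(3) show False by simp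
    qed
  qed
  then show ?thesis
    using lead_exp_in_keys[OF assms(1)] lead_exp_in_keys[OF assms(2)] by (simp add: in_keys_iff)
qed

lemma lead_exp_mult:
  fixes p q :: "'k::field mpolynomial"
  assumes "p \<noteq> 0" "q \<noteq> 0"
  shows "lead_exp (p * q) = lead_exp p + lead_exp q"
  unfolding lead_exp_def[of "p * q"]
proof (rule Max_eqI)
  fix c assume "c \<in> Poly_Mapping.keys (p * q)"
  then obtain a b where "a \<in> Poly_Mapping.keys p" "b \<in> Poly_Mapping.keys q" "c = a + b"
    using keys_mult[of p q] by blast
  then show "c \<le> lead_exp p + lead_exp q"
    by (simp add: add_mono lead_exp_ge)
qed (simp_all add: lead_exp_mult_in_keys assms)

section \<open>Dickson's lemma and Hilbert's basis theorem\<close>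

lemma incseq_subsequences:
  fixes s :: "nat \<Rightarrow> nat \<Rightarrow> nat"
  shows "\<exists>r :: nat \<Rightarrow> nat. strict_mono r \<and> (\<forall>k<n. mono (\<lambda>i. s (r i) k))"
proof (induction n)
  case 0
  show ?case
    by (rule exI[of _ id]) (simp add: strict_mono_def)
next
  case (Suc n)
  then obtain r :: "nat \<Rightarrow> nat" where r: "strict_mono r" "\<forall>k<n. mono (\<lambda>i. s (r i) k)" by blast
  define u where "u i = s (r i) n" for i
  have "\<exists>g :: nat \<Rightarrow> nat. strict_mono g \<and> mono (\<lambda>i. u (g i))"
  proof -
    obtain f :: "nat \<Rightarrow> nat" where f: "strict_mono f" "monoseq (\<lambda>i. u (f i))"
      using seq_monosub by blast
    show ?thesis
    proof (cases "mono (\<lambda>i. u (f i))")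
      case False
      then have dec: "u (f j) \<le> u (f i)" if "i \<le> j" for i j
        using f(2) that by (auto simp: monoseq_def mono_def)
      \<comment> \<open>A decreasing sequence of naturals is constant once it has reached its least
        value; its tail from there on is also increasing.\<close>
      define m where "m = (LEAST v. v \<in> range (\<lambda>i. u (f i)))"
      have "m \<in> range (\<lambda>i. u (f i))"
        unfolding m_def by (rule LeastI) blast
      then obtain i0 where i0: "m = u (f i0)" by blast
      have "u (f (i0 + i)) = m" for i
      proof (rule antisym)
        show "u (f (i0 + i)) \<le> m" using dec i0 by simp
        show "m \<le> u (f (i0 + i))" unfolding m_def by (rule Least_le) blast
      qed
      then show ?thesis
        using f(1) by (intro exI[of _ "\<lambda>i. f (i0 + i)"]) (simp add: strict_mono_def mono_def)
    qed (use f in blast)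
  qed
  then obtain g :: "nat \<Rightarrow> nat" where g: "strict_mono g" "mono (\<lambda>i. u (g i))" by blast
  have "mono (\<lambda>i. s (r (g i)) k)" if "k < Suc n" for k
  proof (cases "k = n")
    case True
    then show ?thesis using g(2) by (simp add: u_def)
  next
    case False
    with that r(2) have "mono (\<lambda>i. s (r i) k)" by simp
    then show ?thesis
      using g(1) by (auto simp: mono_def strict_mono_less_eq)
  qed
  then show ?case
    using strict_mono_o[OF r(1) g(1)] by (intro exI[of _ "r \<circ> g"]) (simp add: comp_def)
qed

text \<open>Along a subsequence that increases in each of the \<open>n\<close> coordinates, the
  first two members are comparable componentwise, so their truncated difference is an exact one. The
  bound on the keys of \<open>d\<close> keeps the quotient monomial inside the ring.\<close>

lemma dickson:
  fixes s :: "nat \<Rightarrow> nat \<Rightarrow>\<^sub>0 nat"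
  assumes "\<And>i. Poly_Mapping.keys (s i) \<subseteq> {..<n}"
  obtains i j d where "i < j" "s j = s i + d" "Poly_Mapping.keys d \<subseteq> {..<n}"
proof -
  obtain r :: "nat \<Rightarrow> nat" where r: "strict_mono r" "\<forall>k<n. mono (\<lambda>i. Poly_Mapping.lookup (s (r i)) k)"
    using incseq_subsequences[of n "\<lambda>i. Poly_Mapping.lookup (s i)"] by blast
  define i j where "i = r 0" and "j = r 1"
  have le: "Poly_Mapping.lookup (s i) k \<le> Poly_Mapping.lookup (s j) k" for k
  proof (cases "k < n")
    case True
    then show ?thesis using r(2) by (simp add: i_def j_def mono_def)
  next
    case False
    then have "k \<notin> Poly_Mapping.keys (s i)" using assms[of i] by auto
    then show ?thesis by (simp add: in_keys_iff)
  qed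
  have "s j = s i + (s j - s i)"
    by (rule poly_mapping_eqI) (simp add: lookup_add lookup_minus le)
  moreover have "Poly_Mapping.keys (s j - s i) \<subseteq> Poly_Mapping.keys (s j)"
    by (auto simp: in_keys_iff lookup_minus)
  then have "Poly_Mapping.keys (s j - s i) \<subseteq> {..<n}"
    using assms[of j] by (rule subset_trans)
  moreover have "i < j"
    using r(1) by (simp add: i_def j_def strict_mono_def)
  ultimately show ?thesis using that by blast
qed

lemma exponent_le_add:
  fixes a d :: "nat \<Rightarrow>\<^sub>0 nat"
  shows "a \<le> a + d"
proof -
  have "\<not> d < 0"
    by transfer (auto simp: less_fun_def)
  then show ?thesis
    using add_left_mono[of 0 d a] by simp
qed

text \<open>The restriction to \<open>n\<close> variables is essential: with infinitely many
  variables the lexicographic order has the descending chain of the single variables 0, 1, 2 and so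
  on. In \<open>n\<close> variables Dickson's lemma produces a later member \<open>f i + d\<close>
  of a descending chain, which cannot be below \<open>f i\<close>.\<close>

lemma wf_exponents:
  "wf {(a, b :: nat \<Rightarrow>\<^sub>0 nat). a < b \<and> Poly_Mapping.keys a \<subseteq> {..<n} \<and> Poly_Mapping.keys b \<subseteq> {..<n}}"
  unfolding wf_iff_no_infinite_down_chain
proof
  assume "\<exists>f. \<forall>i. (f (Suc i), f i) \<in> {(a, b :: nat \<Rightarrow>\<^sub>0 nat). a < b \<and>
    Poly_Mapping.keys a \<subseteq> {..<n} \<and> Poly_Mapping.keys b \<subseteq> {..<n}}"
  then obtain f :: "nat \<Rightarrow> nat \<Rightarrow>\<^sub>0 nat" where
    f: "\<And>i. f (Suc i) < f i" "\<And>i. Poly_Mapping.keys (f i) \<subseteq> {..<n}"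
    by blast
  from f(2) obtain i j d where "i < j" "f j = f i + d" by (rule dickson)
  moreover have "f j \<le> f (Suc i)"
    using less_imp_le[OF f(1)] \<open>i < j\<close>[THEN Suc_leI] by (rule lift_Suc_antimono_le)
  then have "f j < f i"
    using f(1)[of i] by (rule le_less_trans)
  ultimately show False using exponent_le_add[of "f i" d] by simp
qed

text \<open>Reduction by leading terms: subtracting from an element of \<open>J\<close> a scalar
  multiple of an element of \<open>I\<close> with the same leading exponent leaves an element of
  \<open>J\<close> that is zero or has a smaller leading exponent, and well-founded induction
  finishes.\<close>

lemma mpoly_ideal_eqI:
  fixes I J :: "'k::field mpolynomial set"
  assumes I: "ideal I (mpoly_ring n)" and J: "ideal J (mpoly_ring n)" and "I \<subseteq> J"
    and lead: "\<And>p. p \<in> J \<Longrightarrow> p \<noteq> 0 \<Longrightarrow> \<exists>q \<in> I. q \<noteq> 0 \<and> lead_exp q = lead_exp p"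
  shows "I = J"
proof -
  have "\<forall>p. p \<in> J \<longrightarrow> p \<noteq> 0 \<longrightarrow> lead_exp p = a \<longrightarrow> p \<in> I" for a
  proof (induction a rule: wf_induct_rule[OF wf_exponents[of n]])
    case (1 a)
    show ?case
    proof (intro allI impI)
      fix p assume p: "p \<in> J" "p \<noteq> 0" "lead_exp p = a"
      then obtain q where q: "q \<in> I" "q \<noteq> 0" "lead_exp q = a"
        using lead by blast
      have q0: "Poly_Mapping.lookup q a \<noteq> 0"
        using lead_exp_in_keys[OF q(2)] q(3) by (simp add: in_keys_iff)
      \<comment> \<open>The scalar is the quotient of the two leading coefficients, so that the
        terms at \<open>a\<close> cancel in \<open>p - c\<close>.\<close>
      define c where "c = Poly_Mapping.single 0 (Poly_Mapping.lookup p a / Poly_Mapping.lookup q a) * q"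
      have c: "c \<in> I"
        unfolding c_def by (rule mpoly_ideal_closed(5)[OF I q(1)]) (simp add: mpoly_carrier_single)
      have lookup_c: "Poly_Mapping.lookup c b =
          Poly_Mapping.lookup p a / Poly_Mapping.lookup q a * Poly_Mapping.lookup q b" for b
        using lookup_mult_single[of q 0 "Poly_Mapping.lookup p a / Poly_Mapping.lookup q a" b]
        by (simp add: c_def mult.commute)
      have pc: "p - c \<in> J"
        using mpoly_ideal_closed(4)[OF J] p(1) c \<open>I \<subseteq> J\<close> by blast
      have "p - c \<in> I"
      proof (cases "p - c = 0")
        case True
        then show ?thesis by (simp add: mpoly_ideal_closed[OF I])
      next
        case False
        define b where "b = lead_exp (p - c)"
        have b: "b \<in> Poly_Mapping.keys (p - c)"
          unfolding b_def by (rule lead_exp_in_keys[OF False])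
        then have "b \<noteq> a"
          using q0 by (auto simp: in_keys_iff lookup_minus lookup_c)
        moreover have "b \<in> Poly_Mapping.keys p \<or> b \<in> Poly_Mapping.keys q"
          using b by (auto simp: in_keys_iff lookup_minus lookup_c)
        then have "b \<le> a"
          using lead_exp_ge[of b p] lead_exp_ge[of b q] p(3) q(3) by auto
        moreover have "Poly_Mapping.keys a \<subseteq> {..<n}"
          using lead_exp_in_keys[OF p(2)] p mpoly_ideal_closed(1)[OF J p(1)]
          by (auto simp: mpoly_carrier_iff)
        moreover have "Poly_Mapping.keys b \<subseteq> {..<n}"
          using b mpoly_ideal_closed(1)[OF J pc] by (auto simp: mpoly_carrier_iff)
        ultimately have "(b, a) \<in> {(a, b). a < b \<and> Poly_Mapping.keys a \<subseteq> {..<n} \<and>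
            Poly_Mapping.keys b \<subseteq> {..<n}}"
          by simp
        from "1.IH"[OF this] pc False show ?thesis
          by (simp add: b_def)
      qed
      from mpoly_ideal_closed(3)[OF I this c] show "p \<in> I" by simp
    qed
  qed
  then have "p \<in> I" if "p \<in> J" for p
    using that mpoly_ideal_closed(2)[OF I] by (cases "p = 0") auto
  with \<open>I \<subseteq> J\<close> show ?thesis by blast
qed

text \<open>Hilbert's basis theorem. In a strictly increasing chain every step contributes a new leading
  exponent, and none of these is a multiple of an earlier one, against Dickson's lemma.\<close>

lemma mpoly_ring_acc:
  "wf {(J', J). ideal J' (mpoly_ring n :: 'k::field mpolynomial ring) \<and>
    ideal J (mpoly_ring n) \<and> J \<subset> J'}"
  unfolding wf_iff_no_infinite_down_chain
proof
  assume "\<exists>f. \<forall>i. (f (Suc i), f i) \<in> {(J', J). ideal J' (mpoly_ring n :: 'k mpolynomial ring) \<and>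
    ideal J (mpoly_ring n) \<and> J \<subset> J'}"
  then obtain f :: "nat \<Rightarrow> 'k mpolynomial set" where
    f: "\<And>i. ideal (f i) (mpoly_ring n)" "\<And>i. f i \<subset> f (Suc i)"
    by blast
  have mono: "f i \<subseteq> f j" if "i \<le> j" for i j
    using psubset_imp_subset[OF f(2)] that by (rule lift_Suc_mono_le)
  have "\<exists>p. p \<in> f (Suc i) \<and> p \<noteq> 0 \<and> (\<forall>q \<in> f i. q \<noteq> 0 \<longrightarrow> lead_exp q \<noteq> lead_exp p)" for i
  proof (rule ccontr)
    assume "\<not> ?thesis"
    then have "f i = f (Suc i)"
      using f(2)[of i] by (intro mpoly_ideal_eqI[OF f(1) f(1)]) blast+
    with f(2)[of i] show False by simp
  qed
  then obtain p where p: "\<And>i. p i \<in> f (Suc i)" "\<And>i. p i \<noteq> 0"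
    "\<And>i q. q \<in> f i \<Longrightarrow> q \<noteq> 0 \<Longrightarrow> lead_exp q \<noteq> lead_exp (p i)"
    by metis
  have "Poly_Mapping.keys (lead_exp (p i)) \<subseteq> {..<n}" for i
    using lead_exp_in_keys[OF p(2)[of i]] mpoly_ideal_closed(1)[OF f(1) p(1)[of i]]
    by (auto simp: mpoly_carrier_iff)
  then obtain i j d where ij: "i < j" "lead_exp (p j) = lead_exp (p i) + d"
    and d: "Poly_Mapping.keys d \<subseteq> {..<n}"
    by (rule dickson)
  \<comment> \<open>\<open>q\<close> has the leading exponent of \<open>p j\<close>. Since
    \<open>p i\<close> lies in \<open>f (Suc i)\<close> and \<open>Suc i \<le> j\<close>,
    \<open>q\<close> already lies in \<open>f j\<close>, so this exponent was not new at step
    \<open>j\<close>.\<close>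
  define q where "q = p i * Poly_Mapping.single d 1"
  have "p i \<in> f j"
    using p(1)[of i] mono[of "Suc i" j] ij(1) by auto
  then have "q \<in> f j"
    unfolding q_def using d by (intro mpoly_ideal_closed(6)[OF f(1)] mpoly_carrier_single)
  moreover have single: "(Poly_Mapping.single d 1 :: 'k mpolynomial) \<noteq> 0"
    by (metis lookup_single_eq lookup_zero zero_neq_one)
  have "q \<noteq> 0"
    unfolding q_def by (metis empty_iff keys_zero lead_exp_mult_in_keys[OF p(2) single])
  moreover have "lead_exp q = lead_exp (p j)"
    unfolding q_def by (simp add: lead_exp_mult[OF p(2) single] ij(2)) (simp add: lead_exp_def)
  ultimately show False
    using p(3)[of q j] by simp
qed


section \<open>Primality and primariness of \<open>mono(I)\<close>\<close>

text \<open>Terms of f and g whose monomials lie in \<open>I\<close> belong to mono(I) and can be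
  discarded without moving the product out of mono(I). If both remainders were nonzero, the product
  of their leading monomials would lie in \<open>I\<close>, and so would one of the factors, which
  had been discarded. The hypothesis concerns monomials only, so the lemma also serves ideals
  \<open>I\<close> that are not prime.\<close>

lemma primeideal_mono_ideal:
  fixes I :: "'k::field mpolynomial set"
  assumes I: "ideal I (mpoly_ring n)" and one: "1 \<notin> I"
    and prime: "\<And>a b. Poly_Mapping.keys a \<subseteq> {..<n} \<Longrightarrow> Poly_Mapping.keys b \<subseteq> {..<n} \<Longrightarrow>
      Poly_Mapping.single (a + b) 1 \<in> I \<Longrightarrow>
      Poly_Mapping.single a 1 \<in> I \<or> Poly_Mapping.single b 1 \<in> I"
  shows "primeideal (mono_ideal n I) (mpoly_ring n)"
proof (rule primeidealI[OF mono_ideal_ideal mpoly_ring_cring])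
  note M = mono_ideal_ideal[of n I] and iff = mono_ideal_iff[OF I]
  have "1 \<notin> mono_ideal n I"
    using one single_in_mono_ideal_iff[OF I, of 0] by simp
  then show "carrier (mpoly_ring n) \<noteq> mono_ideal n I"
    using mpoly_zero_one_closed(2) by metis
  fix f g :: "'k mpolynomial"
  assume f: "f \<in> carrier (mpoly_ring n)" and g: "g \<in> carrier (mpoly_ring n)"
    and "f \<otimes>\<^bsub>mpoly_ring n\<^esub> g \<in> mono_ideal n I"
  then have fg: "f * g \<in> mono_ideal n I" by simp
  obtain f0 f1 where f01: "f = f0 + f1"
    "Poly_Mapping.keys f0 = {a \<in> Poly_Mapping.keys f. Poly_Mapping.single a 1 \<notin> I}"
    "Poly_Mapping.keys f1 = {a \<in> Poly_Mapping.keys f. Poly_Mapping.single a 1 \<in> I}"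
    by (rule poly_mapping_split)
  obtain g0 g1 where g01: "g = g0 + g1"
    "Poly_Mapping.keys g0 = {a \<in> Poly_Mapping.keys g. Poly_Mapping.single a 1 \<notin> I}"
    "Poly_Mapping.keys g1 = {a \<in> Poly_Mapping.keys g. Poly_Mapping.single a 1 \<in> I}"
    by (rule poly_mapping_split)
  have M1: "f1 \<in> mono_ideal n I" "g1 \<in> mono_ideal n I"
    using f g f01(3) g01(3) by (auto simp: iff mpoly_carrier_iff)
  have f0: "f0 \<in> carrier (mpoly_ring n)"
    using f f01(2) by (auto simp: mpoly_carrier_iff)
  have "f0 * g0 = f * g - f1 * g - f0 * g1"
    by (simp add: f01(1) g01(1) algebra_simps)
  also have "\<dots> \<in> mono_ideal n I"
    by (intro mpoly_ideal_closed(4)[OF M] fg mpoly_ideal_closed(6)[OF M M1(1) g]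
        mpoly_ideal_closed(5)[OF M M1(2) f0])
  finally have f0g0: "f0 * g0 \<in> mono_ideal n I" .
  have "f0 = 0 \<or> g0 = 0"
  proof (rule ccontr)
    assume "\<not> ?thesis"
    then have nz: "f0 \<noteq> 0" "g0 \<noteq> 0" by auto
    then have "Poly_Mapping.single (lead_exp f0 + lead_exp g0) 1 \<in> I"
      using f0g0 lead_exp_mult_in_keys[OF nz] by (auto simp: iff)
    moreover have "lead_exp f0 \<in> Poly_Mapping.keys f0" "lead_exp g0 \<in> Poly_Mapping.keys g0"
      using nz by (auto intro: lead_exp_in_keys)
    ultimately show False
      using prime[of "lead_exp f0" "lead_exp g0"] f g f01(2) g01(2) by (auto simp: mpoly_carrier_iff)
  qed
  then show "f \<in> mono_ideal n I \<or> g \<in> mono_ideal n I"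
    using M1 f01(1) g01(1) by auto
qed

section \<open>Powers, radicals and primary ideals\<close>

lemma single_one_power:
  "(Poly_Mapping.single a 1 :: 'k::field mpolynomial) ^ m = Poly_Mapping.single (\<Sum>i<m. a) 1"
  \<comment> \<open>The multiple of \<open>a\<close> stays an iterated sum:
    \<open>sum_constant\<close> would turn it into a convolution product of exponent
    vectors.\<close>
  by (induction m) (simp_all add: mult_single add.commute del: sum_constant)

lemma lead_exp_power:
  assumes "p \<noteq> 0"
  shows "lead_exp (p ^ m) = (\<Sum>i<m. lead_exp p)"
proof (induction m)
  case 0
  show ?case by (simp add: lead_exp_def)
next
  case (Suc m)
  then show ?case
    using assms by (simp add: lead_exp_mult add.commute del: sum_constant)
qed

text \<open>Instead of the binomial theorem, one factor \<open>p + q\<close> is expanded at a time.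
  The total degree \<open>i + j + s\<close> never drops below \<open>k + l\<close>, so once
  \<open>s = 0\<close> either \<open>k \<le> i\<close> or \<open>l \<le> j\<close>.\<close>

lemma mpoly_ideal_power_sum:
  fixes p q :: "'k::field mpolynomial"
  assumes M: "ideal M (mpoly_ring n)"
    and p: "p \<in> carrier (mpoly_ring n)" "p ^ k \<in> M"
    and q: "q \<in> carrier (mpoly_ring n)" "q ^ l \<in> M"
  shows "(p + q) ^ (k + l) \<in> M"
proof -
  have "p ^ i * q ^ j * (p + q) ^ s \<in> M" if "k + l \<le> i + j + s" for i j s
    using that
  proof (induction s arbitrary: i j)
    case 0
    then consider "k \<le> i" | "l \<le> j" by linarith
    then show ?case
    proof cases
      case 1
      then have eq: "p ^ i * q ^ j = (p ^ (i - k) * q ^ j) * p ^ k"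
        by (simp add: ac_simps flip: power_add)
      have "p ^ i * q ^ j \<in> M"
        by (simp only: eq) (intro mpoly_ideal_closed(5)[OF M] mpoly_carrier_closed
            mpoly_carrier_power p q)
      then show ?thesis by simp
    next
      case 2
      then have eq: "p ^ i * q ^ j = (p ^ i * q ^ (j - l)) * q ^ l"
        by (simp add: ac_simps flip: power_add)
      have "p ^ i * q ^ j \<in> M"
        by (simp only: eq) (intro mpoly_ideal_closed(5)[OF M] mpoly_carrier_closed
            mpoly_carrier_power p q)
      then show ?thesis by simp
    qed
  next
    case (Suc s)
    have "p ^ i * q ^ j * (p + q) ^ Suc s =
        p ^ Suc i * q ^ j * (p + q) ^ s + p ^ i * q ^ Suc j * (p + q) ^ s"
      by (simp add: algebra_simps)
    then show ?case
      using Suc.IH[of "Suc i" j] Suc.IH[of i "Suc j"] Suc.prems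
      by (simp add: mpoly_ideal_closed(3)[OF M])
  qed
  from this[of 0 0 "k + l"] show ?thesis by simp
qed

text \<open>A power of a monomial is a monomial, so it lies in mono(I) as soon as it lies in
  \<open>I\<close>. Thus \<open>g\<close> is a finite sum of terms that are nilpotent modulo
  mono(I).\<close>

lemma power_in_mono_ideal:
  fixes I :: "'k::field mpolynomial set"
  assumes I: "ideal I (mpoly_ring n)" and g: "g \<in> carrier (mpoly_ring n)"
    and rad: "\<And>a. a \<in> Poly_Mapping.keys g \<Longrightarrow> \<exists>m>0. Poly_Mapping.single a 1 ^ m \<in> I"
  shows "\<exists>m>0. g ^ m \<in> mono_ideal n I"
proof -
  note M = mono_ideal_ideal[of n I]
  have "\<exists>m>0. (\<Sum>a\<in>A. Poly_Mapping.single a (Poly_Mapping.lookup g a)) ^ m \<in> mono_ideal n I"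
    if "A \<subseteq> Poly_Mapping.keys g" for A
    using finite_subset[OF that finite_keys] that
  proof (induction A rule: finite_induct)
    case empty
    show ?case
      by (rule exI[of _ 1]) (simp add: mpoly_ideal_closed[OF M])
  next
    case (insert a A)
    define h where "h = (\<Sum>a\<in>A. Poly_Mapping.single a (Poly_Mapping.lookup g a))"
    obtain k where k: "k > 0" "h ^ k \<in> mono_ideal n I"
      using insert by (auto simp: h_def)
    have "Poly_Mapping.keys h \<subseteq> Poly_Mapping.keys g"
      using insert.prems by (auto simp: h_def in_keys_iff lookup_sum_single when_def split: if_splits)
    then have h: "h \<in> carrier (mpoly_ring n)"
      using g by (auto simp: mpoly_carrier_iff)
    have a: "Poly_Mapping.keys a \<subseteq> {..<n}"
      using g insert.prems by (auto simp: mpoly_carrier_iff)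
    obtain l where l: "l > 0" "Poly_Mapping.single a 1 ^ l \<in> I"
      using rad[of a] insert.prems by auto
    then have "Poly_Mapping.single a 1 ^ l \<in> mono_ideal n I"
      using single_in_mono_ideal_iff[OF I] by (simp add: single_one_power)
    moreover have "Poly_Mapping.single a (Poly_Mapping.lookup g a) =
        Poly_Mapping.single 0 (Poly_Mapping.lookup g a) * Poly_Mapping.single a 1"
      by (simp add: mult_single)
    ultimately have "Poly_Mapping.single a (Poly_Mapping.lookup g a) ^ l \<in> mono_ideal n I"
      by (auto simp: power_mult_distrib intro!: mpoly_ideal_closed(5)[OF M] mpoly_carrier_power
          mpoly_carrier_single)
    then have "(Poly_Mapping.single a (Poly_Mapping.lookup g a) + h) ^ (l + k) \<in> mono_ideal n I"
      by (rule mpoly_ideal_power_sum[OF M mpoly_carrier_single[OF a] _ h k(2)])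
    then show ?case
      using insert.hyps k(1) by (intro exI[of _ "l + k"]) (simp add: h_def)
  qed
  from this[OF order_refl] show ?thesis
    by (simp add: poly_mapping_sum_single)
qed

text \<open>From g one discards the part \<open>g1\<close> of terms whose monomials are in the
  radical of \<open>I\<close>. The obstacle is that \<open>g1\<close> need not lie in mono(I), only
  some power of it does; hence the comparison of leading monomials is made for \<open>f0\<close> and
  a power of \<open>g0\<close>.\<close>

lemma primaryideal_mono_ideal:
  fixes I :: "'k::field mpolynomial set"
  assumes "primaryideal I (mpoly_ring n)"
  shows "primaryideal (mono_ideal n I) (mpoly_ring n)"
proof (intro primaryideal.intro mono_ideal_ideal mpoly_ring_cring primaryideal_axioms.intro)
  interpret primaryideal I "mpoly_ring n" by fact
  have I: "ideal I (mpoly_ring n)" by (rule ideal_axioms)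
  note M = mono_ideal_ideal[of n I] and iff = mono_ideal_iff[OF I]
  have "1 \<notin> I"
    using I_notcarr one_imp_carrier by auto
  then have "1 \<notin> mono_ideal n I"
    using single_in_mono_ideal_iff[OF I, of 0] by simp
  then show "carrier (mpoly_ring n) \<noteq> mono_ideal n I"
    using mpoly_zero_one_closed(2) by metis
  fix f g :: "'k mpolynomial"
  assume f: "f \<in> carrier (mpoly_ring n)" and g: "g \<in> carrier (mpoly_ring n)"
    and "f \<otimes>\<^bsub>mpoly_ring n\<^esub> g \<in> mono_ideal n I"
  then have fg: "f * g \<in> mono_ideal n I" by simp
  define rad where "rad a \<longleftrightarrow> (\<exists>m>0. Poly_Mapping.single a 1 ^ m \<in> I)" for a
  obtain f0 f1 where f01: "f = f0 + f1"
    "Poly_Mapping.keys f0 = {a \<in> Poly_Mapping.keys f. Poly_Mapping.single a 1 \<notin> I}"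
    "Poly_Mapping.keys f1 = {a \<in> Poly_Mapping.keys f. Poly_Mapping.single a 1 \<in> I}"
    by (rule poly_mapping_split)
  obtain g0 g1 where g01: "g = g0 + g1"
    "Poly_Mapping.keys g0 = {a \<in> Poly_Mapping.keys g. \<not> rad a}"
    "Poly_Mapping.keys g1 = {a \<in> Poly_Mapping.keys g. rad a}"
    by (rule poly_mapping_split)
  have f1: "f1 \<in> mono_ideal n I"
    using f f01(3) by (auto simp: iff mpoly_carrier_iff)
  have C: "f0 \<in> carrier (mpoly_ring n)" "g0 \<in> carrier (mpoly_ring n)" "g1 \<in> carrier (mpoly_ring n)"
    using f g f01(2) g01(2,3) by (auto simp: mpoly_carrier_iff)
  obtain m where m: "m > 0" "g1 ^ m \<in> mono_ideal n I"
    using power_in_mono_ideal[OF I C(3)] g01(3) by (auto simp: rad_def)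
  have "f0 * g = f * g - f1 * g"
    by (simp add: f01(1) algebra_simps)
  also have "\<dots> \<in> mono_ideal n I"
    by (intro mpoly_ideal_closed(4)[OF M] fg mpoly_ideal_closed(6)[OF M f1 g])
  finally have f0g: "f0 * g \<in> mono_ideal n I" .
  \<comment> \<open>Modulo mono(I), \<open>f0 * g\<close> vanishes, so under the factor
    \<open>f0\<close> each \<open>g0\<close> may be exchanged for \<open>- g1\<close>. For
    \<open>j = m\<close> this turns the nilpotency of \<open>g1\<close> into
    \<open>f0 * g0 ^ m\<close> being in mono(I).\<close>
  have "f0 * g0 ^ j - f0 * (- g1) ^ j \<in> mono_ideal n I" for j
  proof (induction j)
    case 0
    show ?case by (simp add: mpoly_ideal_closed[OF M])
  next
    case (Suc j)
    have "f0 * g0 ^ Suc j - f0 * (- g1) ^ Suc j =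
        g0 ^ j * (f0 * g) - g1 * (f0 * g0 ^ j - f0 * (- g1) ^ j)"
      by (simp add: g01(1) algebra_simps)
    also have "\<dots> \<in> mono_ideal n I"
      by (intro mpoly_ideal_closed(4)[OF M] mpoly_ideal_closed(5)[OF M f0g]
          mpoly_ideal_closed(5)[OF M Suc] mpoly_carrier_power C)
    finally show ?case .
  qed
  from this[of m] have "f0 * g0 ^ m - f0 * (- g1) ^ m \<in> mono_ideal n I" .
  moreover have eq: "f0 * (- g1) ^ m = (f0 * (- 1) ^ m) * g1 ^ m"
    by (metis mult.assoc power_minus)
  have "f0 * (- g1) ^ m \<in> mono_ideal n I"
    unfolding eq
    by (intro mpoly_ideal_closed(5)[OF M m(2)] mpoly_carrier_closed mpoly_carrier_power
        mpoly_carrier_uminus mpoly_zero_one_closed C)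
  ultimately have f0g0: "f0 * g0 ^ m \<in> mono_ideal n I"
    using mpoly_ideal_closed(3)[OF M] by fastforce
  have "f0 = 0 \<or> g0 = 0"
  proof (rule ccontr)
    assume "\<not> ?thesis"
    then have nz: "f0 \<noteq> 0" "g0 \<noteq> 0" "g0 ^ m \<noteq> 0" by auto
    have keys: "lead_exp f0 \<in> Poly_Mapping.keys f0" "lead_exp g0 \<in> Poly_Mapping.keys g0"
      using nz by (auto intro: lead_exp_in_keys)
    have "Poly_Mapping.single (lead_exp f0 + (\<Sum>i<m. lead_exp g0)) 1 \<in> I"
      using f0g0 lead_exp_mult_in_keys[OF nz(1,3)] by (auto simp: iff lead_exp_power[OF nz(2)] simp del: sum_constant)
    then have "Poly_Mapping.single (lead_exp f0) 1 * Poly_Mapping.single (lead_exp g0) 1 ^ m \<in> I"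
      by (simp add: single_one_power mult_single del: sum_constant)
    moreover have "Poly_Mapping.single (lead_exp f0) 1 \<in> carrier (mpoly_ring n)"
      "Poly_Mapping.single (lead_exp g0) 1 ^ m \<in> carrier (mpoly_ring n)"
      using keys C(1,2) unfolding mpoly_carrier_iff[of f0] mpoly_carrier_iff[of g0]
      by (auto intro!: mpoly_carrier_power mpoly_carrier_single)
    ultimately have "Poly_Mapping.single (lead_exp f0) 1 \<in> I \<or>
        (\<exists>k>0. (Poly_Mapping.single (lead_exp g0) 1 ^ m) ^ k \<in> I)"
      using I_primary[of "Poly_Mapping.single (lead_exp f0) 1"
          "Poly_Mapping.single (lead_exp g0) 1 ^ m"] by auto
    \<comment> \<open>Primariness bounds a power of the \<open>m\<close>-th power; the combined
      exponent is positive because \<open>m\<close> is.\<close>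
    then have "Poly_Mapping.single (lead_exp f0) 1 \<in> I \<or> rad (lead_exp g0)"
      unfolding rad_def using m(1) by (metis nat_0_less_mult_iff power_mult)
    then show False
      using keys f01(2) g01(2) by auto
  qed
  then show "f \<in> mono_ideal n I \<or> (\<exists>m::nat. m > 0 \<and> g [^]\<^bsub>mpoly_ring n\<^esub> m \<in> mono_ideal n I)"
    using f1 m f01(1) g01(1) by auto
qed


section \<open>Associated primes of \<open>mono(I)\<close>\<close>

lemma mem_colon_mpoly:
  "r \<in> colon_ideal (mpoly_ring n) M x \<longleftrightarrow> r \<in> carrier (mpoly_ring n) \<and> r * x \<in> M"
  by (simp add: colon_ideal_def)

text \<open>Minimality of the number of terms of \<open>x\<close> is used twice: to show that Q
  contains the monomial of every term of its elements, and to show that the leading monomial of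
  \<open>x\<close> is not annihilated by anything outside Q.\<close>

lemma associated_prime_mono_ideal:
  fixes I :: "'k::field mpolynomial set"
  assumes I: "ideal I (mpoly_ring n)" and Q: "primeideal Q (mpoly_ring n)"
    and "x0 \<in> carrier (mpoly_ring n)" "Q = colon_ideal (mpoly_ring n) (mono_ideal n I) x0"
  obtains a where "Poly_Mapping.keys a \<subseteq> {..<n}"
    "Q = colon_ideal (mpoly_ring n) (mono_ideal n I) (Poly_Mapping.single a 1)"
proof -
  interpret Q: primeideal Q "mpoly_ring n" by fact
  have Qi: "ideal Q (mpoly_ring n)" by (rule Q.ideal_axioms)
  define M where "M = mono_ideal n I"
  have M: "ideal M (mpoly_ring n)" unfolding M_def by (rule mono_ideal_ideal)
  have iff: "p \<in> M \<longleftrightarrow>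
      p \<in> carrier (mpoly_ring n) \<and> (\<forall>a \<in> Poly_Mapping.keys p. Poly_Mapping.single a 1 \<in> I)" for p
    unfolding M_def by (rule mono_ideal_iff[OF I])
  note closed = mpoly_carrier_closed mpoly_carrier_single
  define colon where "colon = colon_ideal (mpoly_ring n) M"
  have mem_colon: "r \<in> colon x \<longleftrightarrow> r \<in> carrier (mpoly_ring n) \<and> r * x \<in> M" for r x
    by (simp add: colon_def mem_colon_mpoly)
  obtain x where x: "x \<in> carrier (mpoly_ring n)" "Q = colon x"
    and min: "\<And>y. y \<in> carrier (mpoly_ring n) \<Longrightarrow> Q = colon y \<Longrightarrow>
      card (Poly_Mapping.keys x) \<le> card (Poly_Mapping.keys y)"
    using ex_has_least_nat[of "\<lambda>x. x \<in> carrier (mpoly_ring n) \<and> Q = colon x" x0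
        "\<lambda>x. card (Poly_Mapping.keys x)"] assms(3,4) by (auto simp: colon_def M_def)
  have Q_iff: "r \<in> Q \<longleftrightarrow> r \<in> carrier (mpoly_ring n) \<and> r * x \<in> M" for r
    using x(2) mem_colon by simp
  have "1 \<notin> Q"
    using Q.I_notcarr Q.one_imp_carrier by auto
  then have "x \<noteq> 0"
    using mpoly_zero_one_closed(2) mpoly_ideal_closed(2)[OF M] by (auto simp: Q_iff)
  define strip where "strip a = x - Poly_Mapping.single a (Poly_Mapping.lookup x a)" for a
  have keys_strip: "Poly_Mapping.keys (strip a) \<subseteq> Poly_Mapping.keys x - {a}" for a
    by (auto simp: strip_def in_keys_iff lookup_minus lookup_single when_def split: if_splits)
  have strip_closed: "strip a \<in> carrier (mpoly_ring n)" for a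
    using x(1) keys_strip[of a] by (auto simp: mpoly_carrier_iff)
  have fewer: "card (Poly_Mapping.keys (strip a * Poly_Mapping.single b 1)) < card (Poly_Mapping.keys x)"
    if "a \<in> Poly_Mapping.keys x" for a b
  proof -
    have "card (Poly_Mapping.keys (strip a * Poly_Mapping.single b 1)) \<le>
        card (Poly_Mapping.keys (strip a))"
      unfolding keys_mult_monomial by (rule card_image_le) simp
    also have "\<dots> \<le> card (Poly_Mapping.keys x - {a})"
      using keys_strip[of a] by (intro card_mono) auto
    also have "\<dots> < card (Poly_Mapping.keys x)"
      using that by (intro psubset_card_mono) auto
    finally show ?thesis .
  qed

  text \<open>Let \<open>m\<close> be the leading monomial of \<open>r \<in> Q\<close>. If \<open>m \<notin> Q\<close>, then \<open>m x\<close> has annihilator \<open>Q\<close> too,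
    and its leading term lies in \<open>M\<close>; dropping it contradicts the minimality of \<open>x\<close>.\<close>
  have lead: "Poly_Mapping.single (lead_exp r) 1 \<in> Q" if r: "r \<in> Q" "r \<noteq> 0" for r
  proof (rule ccontr)
    assume not_in: "Poly_Mapping.single (lead_exp r) 1 \<notin> Q"
    define a b where "a = lead_exp x" and "b = lead_exp r"
    have a: "a \<in> Poly_Mapping.keys x" "Poly_Mapping.keys a \<subseteq> {..<n}"
      using lead_exp_in_keys[OF \<open>x \<noteq> 0\<close>] x(1) by (auto simp: a_def mpoly_carrier_iff)
    have b: "b \<in> Poly_Mapping.keys r" "Poly_Mapping.keys b \<subseteq> {..<n}"
      using lead_exp_in_keys[OF r(2)] r(1) by (auto simp: b_def Q_iff mpoly_carrier_iff)
    have "r * x \<in> M"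
      using r(1) unfolding Q_iff by (rule conjunct2)
    moreover have "b + a \<in> Poly_Mapping.keys (r * x)"
      unfolding a_def b_def by (rule lead_exp_mult_in_keys[OF r(2) \<open>x \<noteq> 0\<close>])
    ultimately have ab: "Poly_Mapping.single (b + a) 1 \<in> I"
      by (rule bspec[OF conjunct2[OF iffD1[OF iff]]])
    have "Poly_Mapping.single a (Poly_Mapping.lookup x a) * Poly_Mapping.single b 1 \<in> carrier (mpoly_ring n)"
      by (rule mpoly_carrier_closed(3)[OF mpoly_carrier_single[OF a(2)] mpoly_carrier_single[OF b(2)]])
    then have lead_in: "Poly_Mapping.single a (Poly_Mapping.lookup x a) * Poly_Mapping.single b 1 \<in> M"
      using ab unfolding iff mult_single by (simp add: add.commute)
    define y where "y = strip a * Poly_Mapping.single b 1"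
    have y: "y \<in> carrier (mpoly_ring n)"
      unfolding y_def by (rule mpoly_carrier_closed(3)[OF strip_closed mpoly_carrier_single[OF b(2)]])
    have "s \<in> Q \<longleftrightarrow> s \<in> colon y" for s
    proof (cases "s \<in> carrier (mpoly_ring n)")
      case True
      have split: "s * Poly_Mapping.single b 1 * x =
          s * y + s * (Poly_Mapping.single a (Poly_Mapping.lookup x a) * Poly_Mapping.single b 1)"
        by (simp add: y_def strip_def algebra_simps)
      have rest: "s * (Poly_Mapping.single a (Poly_Mapping.lookup x a) * Poly_Mapping.single b 1) \<in> M"
        by (rule mpoly_ideal_closed(5)[OF M lead_in True])
      have sb: "Poly_Mapping.single b 1 \<in> carrier (mpoly_ring n)"
        using b(2) by (rule closed)
      have "s \<in> Q \<longleftrightarrow> s * Poly_Mapping.single b 1 \<in> Q"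
        using Q.I_prime[OF True sb] not_in mpoly_ideal_closed(6)[OF Qi _ sb, of s]
        by (auto simp: b_def)
      also have "\<dots> \<longleftrightarrow> s * Poly_Mapping.single b 1 * x \<in> M"
        using closed(3)[OF True sb] by (simp add: Q_iff)
      also have "\<dots> \<longleftrightarrow> s * y \<in> M"
        using mpoly_ideal_closed(3)[OF M _ rest, of "s * y"]
          mpoly_ideal_closed(4)[OF M _ rest, of "s * Poly_Mapping.single b 1 * x"]
        by (auto simp: split)
      finally show ?thesis
        using True by (simp add: mem_colon)
    qed (auto simp: Q_iff mem_colon)
    then have "Q = colon y" by blast
    from min[OF y this] fewer[OF a(1), of b] show False
      by (simp add: y_def)
  qed

  \<comment> \<open>The leading monomial of \<open>r\<close> is in Q, so subtracting the leading
    term stays in Q and lowers the number of terms.\<close>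
  have terms: "\<forall>b \<in> Poly_Mapping.keys r. Poly_Mapping.single b 1 \<in> Q" if "r \<in> Q" for r
    using that
  proof (induction "card (Poly_Mapping.keys r)" arbitrary: r rule: less_induct)
    case less
    show ?case
    proof (cases "r = 0")
      case False
      define b where "b = lead_exp r"
      have b: "b \<in> Poly_Mapping.keys r" "Poly_Mapping.single b 1 \<in> Q"
        using lead_exp_in_keys[OF False] lead[OF less.prems False] by (simp_all add: b_def)
      define r' where "r' = r - Poly_Mapping.single 0 (Poly_Mapping.lookup r b) * Poly_Mapping.single b 1"
      have keys_r': "Poly_Mapping.keys r' = Poly_Mapping.keys r - {b}"
        by (auto simp: r'_def mult_single in_keys_iff lookup_minus lookup_single when_def split: if_splits)
      have "r' \<in> Q"
        unfolding r'_def
        by (intro mpoly_ideal_closed(4)[OF Qi less.prems] mpoly_ideal_closed(5)[OF Qi b(2)] closed) simp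
      moreover have "card (Poly_Mapping.keys r') < card (Poly_Mapping.keys r)"
        unfolding keys_r' using b(1) by (intro psubset_card_mono) auto
      ultimately have "\<forall>b \<in> Poly_Mapping.keys r'. Poly_Mapping.single b 1 \<in> Q"
        by (intro less.hyps)
      then show ?thesis
        using b(2) by (auto simp: keys_r')
    qed simp
  qed

  define a where "a = lead_exp x"
  have a: "a \<in> Poly_Mapping.keys x" "Poly_Mapping.keys a \<subseteq> {..<n}"
    using lead_exp_in_keys[OF \<open>x \<noteq> 0\<close>] x(1) by (auto simp: a_def mpoly_carrier_iff)
  have sub: "Q \<subseteq> colon (Poly_Mapping.single a 1)"
  proof
    fix r assume r: "r \<in> Q"
    have rC: "r \<in> carrier (mpoly_ring n)"
      by (rule mpoly_ideal_closed(1)[OF Qi r])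
    \<comment> \<open>A monomial in Q multiplies \<open>x\<close> into \<open>M\<close>.
      Multiplication by a monomial merely shifts the exponents of \<open>x\<close>, so no
      cancellation can hide the shifted \<open>a\<close>.\<close>
    have "Poly_Mapping.single (b + a) 1 \<in> I" if "b \<in> Poly_Mapping.keys r" for b
    proof -
      have "x * Poly_Mapping.single b 1 \<in> M"
        using terms[OF r] that by (simp add: Q_iff mult.commute)
      moreover have "a + b \<in> Poly_Mapping.keys (x * Poly_Mapping.single b 1)"
        using a(1) by (simp add: keys_mult_monomial)
      ultimately have "Poly_Mapping.single (a + b) 1 \<in> I"
        by (rule bspec[OF conjunct2[OF iffD1[OF iff]]])
      then show ?thesis by (simp add: add.commute)
    qed
    then have "r * Poly_Mapping.single a 1 \<in> M"
      unfolding iff using closed(3)[OF rC closed(4)[OF a(2)]] by (simp add: keys_mult_monomial)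
    with rC show "r \<in> colon (Poly_Mapping.single a 1)"
      by (simp add: mem_colon)
  qed
  moreover have "colon (Poly_Mapping.single a 1) \<subseteq> Q"
  proof (rule ccontr)
    assume "\<not> ?thesis"
    then obtain s where s: "s \<in> carrier (mpoly_ring n)" "s * Poly_Mapping.single a 1 \<in> M" "s \<notin> Q"
      using mem_colon by blast
    define c where "c = (Poly_Mapping.single 0 (Poly_Mapping.lookup x a) :: 'k mpolynomial)"
    have c: "c \<in> carrier (mpoly_ring n)"
      unfolding c_def by (rule closed) simp
    have split: "u * x = u * strip a + c * (u * Poly_Mapping.single a 1)" for u
    proof -
      have "Poly_Mapping.single a (Poly_Mapping.lookup x a) = c * Poly_Mapping.single a 1"
        by (simp add: c_def mult_single)
      then show ?thesis
        by (simp add: strip_def algebra_simps)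
    qed
    \<comment> \<open>Q annihilates both \<open>x\<close> and its leading monomial, hence also the
      remainder. Conversely, if \<open>r\<close> annihilates the remainder, then
      \<open>r * s\<close> annihilates all of \<open>x\<close>, and primality with
      \<open>s \<notin> Q\<close> gives \<open>r \<in> Q\<close>.\<close>
    have "Q = colon (strip a)"
    proof
      show "Q \<subseteq> colon (strip a)"
      proof
        fix r assume r: "r \<in> Q"
        then have "c * (r * Poly_Mapping.single a 1) \<in> M"
          using sub by (intro mpoly_ideal_closed(5)[OF M _ c]) (auto simp: mem_colon)
        then have "r * x - c * (r * Poly_Mapping.single a 1) \<in> M"
          using r by (intro mpoly_ideal_closed(4)[OF M]) (auto simp: Q_iff)
        then show "r \<in> colon (strip a)"
          using r by (simp add: split mem_colon Q_iff)
      qed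
      show "colon (strip a) \<subseteq> Q"
      proof
        fix r assume "r \<in> colon (strip a)"
        then have r: "r \<in> carrier (mpoly_ring n)" "r * strip a \<in> M"
          by (auto simp: mem_colon)
        have "s * (r * strip a) + (c * r) * (s * Poly_Mapping.single a 1) \<in> M"
          by (intro mpoly_ideal_closed(3)[OF M] mpoly_ideal_closed(5)[OF M r(2) s(1)]
              mpoly_ideal_closed(5)[OF M s(2)] closed c r)
        moreover have "(r * s) * x = s * (r * strip a) + (c * r) * (s * Poly_Mapping.single a 1)"
          by (simp add: split distrib_left ac_simps)
        ultimately have "r * s \<in> Q"
          using r s by (simp add: Q_iff closed)
        then show "r \<in> Q"
          using Q.I_prime[OF r(1) s(1)] s(3) by simp
      qed
    qed
    \<comment> \<open>The exponent 0 makes the monomial factor equal to 1, so the count applies to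
      \<open>strip a\<close> itself.\<close>
    from min[OF strip_closed this] fewer[OF a(1), of 0] show False
      by simp
  qed
  ultimately have "Q = colon (Poly_Mapping.single a 1)" by blast
  with a(2) show ?thesis
    by (intro that) (simp_all add: colon_def M_def)
qed

text \<open>The facts are stated with the ring operations so that they discharge the conditions on
  the multiplicative set in \<open>exists_prime_colon_ideal\<close>.\<close>

lemma monomials_diff_prime_closed:
  fixes Q :: "'k::field mpolynomial set"
  assumes "primeideal Q (mpoly_ring n)"
  shows "monomials n - Q \<subseteq> carrier (mpoly_ring n)" "\<one>\<^bsub>mpoly_ring n\<^esub> \<in> monomials n - Q"
    "\<And>s t. s \<in> monomials n - Q \<Longrightarrow> t \<in> monomials n - Q \<Longrightarrow> s \<otimes>\<^bsub>mpoly_ring n\<^esub> t \<in> monomials n - Q"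
proof -
  interpret Q: primeideal Q "mpoly_ring n" by fact
  show C: "monomials n - Q \<subseteq> carrier (mpoly_ring n)"
    using monomials_subset_carrier by blast
  have "1 \<in> monomials n"
    unfolding monomials_eq by (auto intro!: exI[of _ 0])
  moreover have "1 \<notin> Q"
    using Q.I_notcarr Q.one_imp_carrier by auto
  ultimately show "\<one>\<^bsub>mpoly_ring n\<^esub> \<in> monomials n - Q" by simp
  fix s t assume st: "s \<in> monomials n - Q" "t \<in> monomials n - Q"
  have "s * t \<in> monomials n"
  proof -
    obtain a b where "s = Poly_Mapping.single a 1" "t = Poly_Mapping.single b 1"
      "Poly_Mapping.keys a \<subseteq> {..<n}" "Poly_Mapping.keys b \<subseteq> {..<n}"
      using st by (auto simp: monomials_eq)
    then show ?thesis
      using keys_add[of a b] by (auto simp: monomials_eq mult_single)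
  qed
  moreover have "s * t \<notin> Q"
    using st C Q.I_prime[of s t] by auto
  ultimately show "s \<otimes>\<^bsub>mpoly_ring n\<^esub> t \<in> monomials n - Q" by simp
qed

lemma associated_primes_mono_ideal:
  fixes I :: "'k::field mpolynomial set"
  assumes I: "ideal I (mpoly_ring n)"
    and "Q \<in> associated_primes (mpoly_ring n) (quot_module (mpoly_ring n) (mono_ideal n I))"
  obtains P where "P \<in> associated_primes (mpoly_ring n) (quot_module (mpoly_ring n) I)"
    "Q = mono_ideal n P"
proof -
  note assoc = associated_primes_quot_module[OF mpoly_ring_cring]
  obtain x where Q: "primeideal Q (mpoly_ring n)" and x: "x \<in> carrier (mpoly_ring n)"
    "Q = colon_ideal (mpoly_ring n) (mono_ideal n I) x"
    using assms(2) by (auto simp: assoc[OF mono_ideal_ideal])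
  then obtain a where a: "Poly_Mapping.keys a \<subseteq> {..<n}"
    "Q = colon_ideal (mpoly_ring n) (mono_ideal n I) (Poly_Mapping.single a 1)"
    by (rule associated_prime_mono_ideal[OF I])
  define m where "m = (Poly_Mapping.single a 1 :: 'k mpolynomial)"
  have m: "m \<in> carrier (mpoly_ring n)"
    unfolding m_def using a(1) by (rule mpoly_carrier_single)
  define J where "J = colon_ideal (mpoly_ring n) I m"
  have J: "ideal J (mpoly_ring n)"
    unfolding J_def by (rule colon_ideal_ideal[OF mpoly_ring_cring I m])
  \<comment> \<open>Multiplication by the monomial \<open>m\<close> shifts exponents injectively, so
    membership of \<open>p * m\<close> in mono(I) can be tested on each term of \<open>p\<close>
    separately. For a general factor the colon ideal and mono do not commute.\<close>
  have "Q = mono_ideal n J"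
  proof (intro Set.set_eqI)
    fix p :: "'k mpolynomial"
    have "p \<in> Q \<longleftrightarrow> p \<in> carrier (mpoly_ring n) \<and>
        (\<forall>b \<in> Poly_Mapping.keys p. Poly_Mapping.single (b + a) 1 \<in> I)"
      using m mpoly_carrier_closed(3)[of p n m]
      by (auto simp: a(2) mem_colon_mpoly mono_ideal_iff[OF I] keys_mult_monomial m_def)
    also have "\<dots> \<longleftrightarrow> p \<in> mono_ideal n J"
      unfolding mono_ideal_iff[OF J]
      by (auto simp: J_def mem_colon_mpoly m_def mult_single mpoly_carrier_iff)
    finally show "p \<in> Q \<longleftrightarrow> p \<in> mono_ideal n J" .
  qed
  then have QJ: "Q \<inter> monomials n = J \<inter> monomials n"
    by (auto simp: monomials_eq single_in_mono_ideal_iff[OF J])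
  then have "J \<inter> (monomials n - Q) = {}" by blast
  note disjoint = this[unfolded J_def]
  obtain y where y: "y \<in> carrier (mpoly_ring n)"
    "primeideal (colon_ideal (mpoly_ring n) I y) (mpoly_ring n)"
    "J \<subseteq> colon_ideal (mpoly_ring n) I y"
    "colon_ideal (mpoly_ring n) I y \<inter> (monomials n - Q) = {}"
    unfolding J_def
    by (rule exists_prime_colon_ideal[OF mpoly_ring_cring I mpoly_ring_acc
          monomials_diff_prime_closed[OF Q] m disjoint])
  define P where "P = colon_ideal (mpoly_ring n) I y"
  \<comment> \<open>Containing \<open>J\<close> gives one inclusion; the other holds because a
    monomial of \<open>P\<close> cannot lie outside Q.\<close>
  have "P \<inter> monomials n = J \<inter> monomials n"
    using y(3,4) QJ unfolding P_def by blast
  then have "Q = mono_ideal n P"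
    using \<open>Q = mono_ideal n J\<close> mono_ideal_cong by metis
  moreover have "P \<in> associated_primes (mpoly_ring n) (quot_module (mpoly_ring n) I)"
    unfolding assoc[OF I] P_def using y(1,2) by blast
  ultimately show ?thesis using that by blast
qed

section \<open>Minimal primes and the primality of mono(I)\<close>

lemma exists_minimal_prime_mono_ideal_eq:
  fixes I :: "'k::field mpolynomial set"
  assumes I: "ideal I (mpoly_ring n)" and M: "primeideal (mono_ideal n I) (mpoly_ring n)"
  obtains P where "P \<in> minimal_primes (mpoly_ring n) I" "mono_ideal n I = mono_ideal n P"
proof -
  have colon_1: "colon_ideal (mpoly_ring n) I 1 = I"
    using mpoly_ideal_closed(1)[OF I] by (auto simp: mem_colon_mpoly)
  have eq: "mono_ideal n I \<inter> monomials n = I \<inter> monomials n"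
    by (auto simp: monomials_eq single_in_mono_ideal_iff[OF I])
  then have disjoint: "colon_ideal (mpoly_ring n) I 1 \<inter> (monomials n - mono_ideal n I) = {}"
    unfolding colon_1 by blast
  obtain y where y: "primeideal (colon_ideal (mpoly_ring n) I y) (mpoly_ring n)"
    "colon_ideal (mpoly_ring n) I 1 \<subseteq> colon_ideal (mpoly_ring n) I y"
    "colon_ideal (mpoly_ring n) I y \<inter> (monomials n - mono_ideal n I) = {}"
    by (rule exists_prime_colon_ideal[OF mpoly_ring_cring I mpoly_ring_acc
          monomials_diff_prime_closed[OF M] mpoly_zero_one_closed(2) disjoint])
  from y(1) y(2)[unfolded colon_1] obtain P where
    P: "P \<in> minimal_primes (mpoly_ring n) I" "P \<subseteq> colon_ideal (mpoly_ring n) I y"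
    by (rule minimal_prime_below)
  \<comment> \<open>\<open>P\<close> lies between \<open>I\<close> and a prime whose monomials all
    belong to \<open>I\<close>.\<close>
  have "I \<inter> monomials n = P \<inter> monomials n"
    using P y(3) eq by (auto simp: minimal_primes_def)
  with P(1) show ?thesis
    by (intro that[of P] mono_ideal_cong)
qed

lemma primeideal_mono_ideal_of_prime:
  fixes P :: "'k::field mpolynomial set"
  assumes "primeideal P (mpoly_ring n)"
  shows "primeideal (mono_ideal n P) (mpoly_ring n)"
proof -
  interpret P: primeideal P "mpoly_ring n" by fact
  show ?thesis
  proof (rule primeideal_mono_ideal[OF P.ideal_axioms])
    show "1 \<notin> P"
      using P.I_notcarr P.one_imp_carrier by auto
    fix a b assume ab: "Poly_Mapping.keys a \<subseteq> {..<n}" "Poly_Mapping.keys b \<subseteq> {..<n}"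
      and "Poly_Mapping.single (a + b) 1 \<in> P"
    then have "Poly_Mapping.single a 1 * Poly_Mapping.single b 1 \<in> P"
      by (simp add: mult_single)
    then show "Poly_Mapping.single a 1 \<in> P \<or> Poly_Mapping.single b 1 \<in> P"
      using P.I_prime[OF mpoly_carrier_single[OF ab(1)] mpoly_carrier_single[OF ab(2)]] by simp
  qed
qed

lemma mono_ideal_mono:
  fixes I J :: "'k::field mpolynomial set"
  assumes "ideal I (mpoly_ring n)" "ideal J (mpoly_ring n)" "I \<subseteq> J"
  shows "mono_ideal n I \<subseteq> mono_ideal n J"
  using subsetD[OF assms(3)] by (auto simp: mono_ideal_iff[OF assms(1)] mono_ideal_iff[OF assms(2)])

text \<open>If mono(I) = 0, then \<open>I\<close> contains no monomial and the monomial criterion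
  holds vacuously. This reduces the statement about mono(I) = 0 to the characterization of primality
  by minimal primes.\<close>

lemma primeideal_mono_ideal_zero:
  fixes I :: "'k::field mpolynomial set"
  assumes I: "ideal I (mpoly_ring n)" and zero: "mono_ideal n I = {0}"
  shows "primeideal (mono_ideal n I) (mpoly_ring n)"
proof (rule primeideal_mono_ideal[OF I])
  have none: "Poly_Mapping.single a 1 \<notin> I" for a
  proof
    assume "Poly_Mapping.single a 1 \<in> I"
    then have "(Poly_Mapping.single a 1 :: 'k mpolynomial) = 0"
      using zero single_in_mono_ideal_iff[OF I, of a] by simp
    then show False
      by (metis lookup_single_eq lookup_zero zero_neq_one)
  qed
  show "1 \<notin> I"
    using none[of 0] by simp
  show "Poly_Mapping.single a 1 \<in> I \<or> Poly_Mapping.single b 1 \<in> I"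
    if "Poly_Mapping.single (a + b) 1 \<in> I" for a b
    using none[of "a + b"] that by simp
qed

theorem proposition1p2:
  fixes n :: nat and I :: "'k::field mpolynomial set"
  assumes "ideal I (mpoly_ring n)"
  shows
    "(primeideal I (mpoly_ring n) \<longrightarrow> primeideal (mono_ideal n I) (mpoly_ring n)) \<and>
     (primaryideal I (mpoly_ring n) \<longrightarrow> primaryideal (mono_ideal n I) (mpoly_ring n)) \<and>
     associated_primes (mpoly_ring n) (quot_module (mpoly_ring n) (mono_ideal n I))
       \<subseteq> {mono_ideal n P | P. P \<in> associated_primes (mpoly_ring n) (quot_module (mpoly_ring n) I)} \<and>
     (primeideal (mono_ideal n I) (mpoly_ring n)
       \<longleftrightarrow> (\<exists>P \<in> minimal_primes (mpoly_ring n) I. mono_ideal n I = mono_ideal n P)) \<and>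
     (mono_ideal n I = {\<zero>\<^bsub>mpoly_ring n\<^esub>}
       \<longleftrightarrow> (\<exists>P \<in> minimal_primes (mpoly_ring n) I. mono_ideal n P = {\<zero>\<^bsub>mpoly_ring n\<^esub>}))"
proof (intro conjI impI)
  let ?R = "mpoly_ring n :: 'k mpolynomial ring"
  have minimalD: "primeideal P ?R" "ideal P ?R" "I \<subseteq> P" if "P \<in> minimal_primes ?R I" for P
    using that by (simp_all add: minimal_primes_def primeideal_def)
  show "primeideal (mono_ideal n I) ?R" if "primeideal I ?R"
    using that by (rule primeideal_mono_ideal_of_prime)
  show "primaryideal (mono_ideal n I) ?R" if "primaryideal I ?R"
    using that by (rule primaryideal_mono_ideal)
  show "associated_primes ?R (quot_module ?R (mono_ideal n I))
      \<subseteq> {mono_ideal n P | P. P \<in> associated_primes ?R (quot_module ?R I)}"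
  proof
    fix Q assume "Q \<in> associated_primes ?R (quot_module ?R (mono_ideal n I))"
    then obtain P where "P \<in> associated_primes ?R (quot_module ?R I)" "Q = mono_ideal n P"
      by (rule associated_primes_mono_ideal[OF assms])
    then show "Q \<in> {mono_ideal n P | P. P \<in> associated_primes ?R (quot_module ?R I)}" by blast
  qed
  show prime_iff: "primeideal (mono_ideal n I) ?R
      \<longleftrightarrow> (\<exists>P \<in> minimal_primes ?R I. mono_ideal n I = mono_ideal n P)"
    using exists_minimal_prime_mono_ideal_eq[OF assms] minimalD(1) primeideal_mono_ideal_of_prime
    by metis
  show "mono_ideal n I = {\<zero>\<^bsub>?R\<^esub>} \<longleftrightarrow> (\<exists>P \<in> minimal_primes ?R I. mono_ideal n P = {\<zero>\<^bsub>?R\<^esub>})"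
  proof
    assume "mono_ideal n I = {\<zero>\<^bsub>?R\<^esub>}"
    then show "\<exists>P \<in> minimal_primes ?R I. mono_ideal n P = {\<zero>\<^bsub>?R\<^esub>}"
      using primeideal_mono_ideal_zero[OF assms] prime_iff by auto
  next
    assume "\<exists>P \<in> minimal_primes ?R I. mono_ideal n P = {\<zero>\<^bsub>?R\<^esub>}"
    then obtain P where P: "P \<in> minimal_primes ?R I" "mono_ideal n P = {0}" by auto
    \<comment> \<open>This direction needs only \<open>I \<subseteq> P\<close> and the monotonicity
      of mono.\<close>
    then have "mono_ideal n I \<subseteq> {0}"
      using mono_ideal_mono[OF assms minimalD(2,3)[OF P(1)]] by simp
    then show "mono_ideal n I = {\<zero>\<^bsub>?R\<^esub>}"
      using mpoly_ideal_closed(2)[OF mono_ideal_ideal[of n I]] by auto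
  qed
qed

end
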